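(* (a) Let $N=2m$, with $N=p^{\alpha}+1$ where $p$ is a prime number and $\alpha\in\mathbb{N}$. Then there exists an optimal Grassmannian frame $\{f_k\}_{k=1}^{N}$ in $\mathbb{R}^m$, which can be constructed explicitly. (b) Let $N=2m$, with $m=2^{\alpha}$ and $\alpha\in\mathbb{N}$. Then there exists an optimal Grassmannian frame $\{f_k\}_{k=1}^{N}$ in $\mathbb{C}^m$, which can be constructed explicitly.
   Context: Let $\mathbb{E}=\mathbb{R}$ or $\mathbb{C}$. A frame $\{f_k\}_{k=1}^N$ for $\mathbb{E}^m$ is a finite sequence of vectors for which there exist constants $A,B>0$ with $A\|f\|^2\le\sum_{k=1}^N|\langle f,f_k\rangle|^2\le B\|f\|^2$ for all $f\in\mathbb{E}^m$ (equivalently, the $f_k$ span $\mathbb{E}^m$). It is uniform if $\|f_k\|=1$ for all $k$. Every uniform frame satisfies $\max_{k\ne l}|\langle f_k,f_l\rangle|\ge\sqrt{\frac{N-m}{m(N-1)}}$; an optimal Grassmannian frame in $\mathbb{E}^m$ is a uniform frame $\{f_k\}_{k=1}^N$ for $\mathbb{E}^m$ for which equality holds, i.e. $\max_{k\ne l}|\langle f_k,f_l\rangle|=\sqrt{\frac{N-m}{m(N-1)}}$. For $N=2m$ this value is $1/\sqrt{2m-1}$.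
   Formalization: Part (a) is proved with the added condition p^α ≡ 1 (mod 4); without it the claim is false (p=3, α=1: no such frame of 4 vectors in R^2). The remark "can be constructed explicitly" is rendered only as existence. *)

theory Defs
  imports "HOL-Analysis.Analysis" "HOL-Computational_Algebra.Primes"
begin

text \<open>On \<^typ>\<open>complex ^ 'm\<close> the library's \<^const>\<open>inner\<close> is the real part of the
  Hermitian product; the latter is needed here.  The library norm on \<^typ>\<open>complex ^ 'm\<close>
  is the one induced by it.\<close>

definition hermitian_inner :: "complex ^ 'm \<Rightarrow> complex ^ 'm \<Rightarrow> complex" where
  "hermitian_inner x y = (\<Sum>i\<in>UNIV. x $ i * cnj (y $ i))"

lemma hermitian_inner_self: "hermitian_inner x x = of_real ((norm x)\<^sup>2)"
proof -
  have "(norm x)\<^sup>2 = (\<Sum>i\<in>UNIV. (norm (x $ i))\<^sup>2)"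
    by (simp add: norm_vec_def L2_set_def sum_nonneg)
  then show ?thesis
    by (simp add: hermitian_inner_def complex_norm_square del: of_real_power)
qed

text \<open>A finite sequence of vectors is given by the values of a function at \<open>1, \<dots>, N\<close>.  The
  parameter \<open>ip\<close> is the inner product of the space: \<^const>\<open>inner\<close> on \<^typ>\<open>real ^ 'm\<close>,
  \<^const>\<open>hermitian_inner\<close> on \<^typ>\<open>complex ^ 'm\<close>.\<close>

definition is_frame ::
  "('e::real_normed_field ^ 'm \<Rightarrow> 'e ^ 'm \<Rightarrow> 'e) \<Rightarrow> nat \<Rightarrow> (nat \<Rightarrow> 'e ^ 'm) \<Rightarrow> bool" where
  "is_frame ip N f \<longleftrightarrow>
     (\<exists>A B. 0 < A \<and> 0 < B \<and>
        (\<forall>v. A * (norm v)\<^sup>2 \<le> (\<Sum>k=1..N. (norm (ip v (f k)))\<^sup>2) \<and>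
             (\<Sum>k=1..N. (norm (ip v (f k)))\<^sup>2) \<le> B * (norm v)\<^sup>2))"

definition uniform_frame ::
  "('e::real_normed_field ^ 'm \<Rightarrow> 'e ^ 'm \<Rightarrow> 'e) \<Rightarrow> nat \<Rightarrow> (nat \<Rightarrow> 'e ^ 'm) \<Rightarrow> bool" where
  "uniform_frame ip N f \<longleftrightarrow> is_frame ip N f \<and> (\<forall>k\<in>{1..N}. norm (f k) = 1)"

text \<open>Only meaningful for \<open>N \<ge> 2\<close>; for smaller \<open>N\<close> the maximum is over the empty set.\<close>

definition max_correlation ::
  "('e::real_normed_field ^ 'm \<Rightarrow> 'e ^ 'm \<Rightarrow> 'e) \<Rightarrow> nat \<Rightarrow> (nat \<Rightarrow> 'e ^ 'm) \<Rightarrow> real" where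
  "max_correlation ip N f =
     Max {norm (ip (f k) (f l)) | k l. k \<in> {1..N} \<and> l \<in> {1..N} \<and> k \<noteq> l}"

definition optimal_grassmannian_frame ::
  "('e::real_normed_field ^ 'm \<Rightarrow> 'e ^ 'm \<Rightarrow> 'e) \<Rightarrow> nat \<Rightarrow> (nat \<Rightarrow> 'e ^ 'm) \<Rightarrow> bool" where
  "optimal_grassmannian_frame ip N f \<longleftrightarrow>
     uniform_frame ip N f \<and>
     max_correlation ip N f =
       sqrt ((real N - real CARD('m)) / (real CARD('m) * (real N - 1)))"

lemma max_correlation_ge:
  assumes "k \<in> {1..N}" "l \<in> {1..N}" "k \<noteq> l"
  shows "norm (ip (f k) (f l)) \<le> max_correlation ip N f"
proof -
  have "finite ((\<lambda>(k, l). norm (ip (f k) (f l))) ` ({1..N} \<times> {1..N}))"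
    by simp
  then have "finite {norm (ip (f k) (f l)) | k l. k \<in> {1..N} \<and> l \<in> {1..N} \<and> k \<noteq> l}"
    by (rule rev_finite_subset) auto
  then show ?thesis
    unfolding max_correlation_def using assms by (intro Max_ge) auto
qed

text \<open>Real optimal Grassmannian frames with \<open>N = 2 m = p ^ \<alpha> + 1\<close> do not exist for every prime
  power: the construction uses a symmetric conference matrix of order \<open>N\<close>, which requires
  \<open>p ^ \<alpha> mod 4 = 1\<close>.  The smallest case outside this condition, \<open>p = 3\<close>, \<open>\<alpha> = 1\<close>, \<open>m = 2\<close>,
  \<open>N = 4\<close>, already fails.\<close>

lemma no_optimal_grassmannian_frame_real_2_4:
  fixes f :: "nat \<Rightarrow> real ^ 2"
  shows "\<not> optimal_grassmannian_frame inner 4 f"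
proof
  assume opt: "optimal_grassmannian_frame inner 4 f"
  define x y where "x k = f k $ 1" and "y k = f k $ 2" for k
  have ip: "f k \<bullet> f l = x k * x l + y k * y l" for k l
    by (simp add: x_def y_def inner_vec_def sum_2)
  have unit: "(x k)\<^sup>2 + (y k)\<^sup>2 = 1" if "k \<in> {1..4}" for k
  proof -
    have "norm (f k) = 1"
      using opt that by (simp add: optimal_grassmannian_frame_def uniform_frame_def)
    then have "f k \<bullet> f k = 1"
      by (simp add: norm_eq_1)
    then show ?thesis
      by (simp add: ip power2_eq_square)
  qed
  define c where "c k l = f k \<bullet> f l" for k l
  have le: "(c k l)\<^sup>2 \<le> 1/3" if "k \<in> {1..4}" "l \<in> {1..4}" "k \<noteq> l" for k l
  proof -
    have "\<bar>c k l\<bar> \<le> sqrt (1/3)"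
      using max_correlation_ge[OF that, of inner f] opt
      by (simp add: optimal_grassmannian_frame_def c_def)
    then have "\<bar>c k l\<bar>\<^sup>2 \<le> (sqrt (1/3))\<^sup>2"
      by (intro power_mono) auto
    then show ?thesis by simp
  qed
  define P where "P k l = ((x k)\<^sup>2 - (y k)\<^sup>2) * ((x l)\<^sup>2 - (y l)\<^sup>2) + (2 * x k * y k) * (2 * x l * y l)"
    for k l
  have dbl: "P k l = 2 * (c k l)\<^sup>2 - 1" if "k \<in> {1..4}" "l \<in> {1..4}" for k l
  proof -
    have "P k l = 2 * (c k l)\<^sup>2 - ((x k)\<^sup>2 + (y k)\<^sup>2) * ((x l)\<^sup>2 + (y l)\<^sup>2)"
      unfolding P_def c_def ip by (simp add: power2_eq_square algebra_simps)
    then show ?thesis using unit[OF that(1)] unit[OF that(2)] by simp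
  qed
  have self: "P k k = 1" if "k \<in> {1..4}" for k
    using dbl[OF that that] unit[OF that] by (simp add: c_def ip power2_eq_square)
  have "0 \<le> ((x 1)\<^sup>2 - (y 1)\<^sup>2 + ((x 2)\<^sup>2 - (y 2)\<^sup>2) + ((x 3)\<^sup>2 - (y 3)\<^sup>2) + ((x 4)\<^sup>2 - (y 4)\<^sup>2))\<^sup>2
      + (2 * x 1 * y 1 + 2 * x 2 * y 2 + 2 * x 3 * y 3 + 2 * x 4 * y 4)\<^sup>2"
    by simp
  also have "\<dots> = P 1 1 + P 2 2 + P 3 3 + P 4 4
      + 2 * (P 1 2 + P 1 3 + P 1 4 + P 2 3 + P 2 4 + P 3 4)"
    unfolding P_def by algebra
  finally have "(c 1 2)\<^sup>2 + (c 1 3)\<^sup>2 + (c 1 4)\<^sup>2 + (c 2 3)\<^sup>2 + (c 2 4)\<^sup>2 + (c 3 4)\<^sup>2 \<ge> 2"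
    by (simp add: self dbl)
  then have eq: "(c 1 2)\<^sup>2 = 1/3" "(c 1 3)\<^sup>2 = 1/3" "(c 2 3)\<^sup>2 = 1/3"
    using le[of 1 2] le[of 1 3] le[of 1 4] le[of 2 3] le[of 2 4] le[of 3 4] by simp_all
  have "((x 1)\<^sup>2 + (y 1)\<^sup>2) * ((x 2)\<^sup>2 + (y 2)\<^sup>2) * ((x 3)\<^sup>2 + (y 3)\<^sup>2) + 2 * (c 1 2 * c 1 3 * c 2 3)
      - (c 1 2)\<^sup>2 * ((x 3)\<^sup>2 + (y 3)\<^sup>2) - (c 1 3)\<^sup>2 * ((x 2)\<^sup>2 + (y 2)\<^sup>2)
      - (c 2 3)\<^sup>2 * ((x 1)\<^sup>2 + (y 1)\<^sup>2) = 0"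
    unfolding c_def ip by algebra
  moreover have u: "(x 1)\<^sup>2 + (y 1)\<^sup>2 = 1" "(x 2)\<^sup>2 + (y 2)\<^sup>2 = 1" "(x 3)\<^sup>2 + (y 3)\<^sup>2 = 1"
    by (rule unit, simp)+
  ultimately have "c 1 2 * c 1 3 * c 2 3 = 0"
    unfolding eq u by linarith
  then show False using eq by auto
qed

end

theory Submission imports Defs
begin

text \<open>If \<open>Q\<close> is a Hermitian \<open>2m \<times> 2m\<close> matrix with zero diagonal, unimodular off-diagonal entries
  and \<open>Q\<^sup>2 = (2m - 1) I\<close>, then \<open>(I + Q / sqrt (2m - 1)) / 2\<close> is an orthogonal projection of
  trace \<open>m\<close>, so twice it is the Gram matrix of \<open>2m\<close> vectors in dimension \<open>m\<close>, and these form an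
  optimal Grassmannian frame.  In the real case \<open>Q\<close> is the Paley matrix of the field with
  \<open>q = p ^ \<alpha>\<close> elements; in the complex case \<open>Q = \<i> C\<close> for a skew conference matrix \<open>C\<close> obtained by
  repeated doubling.

  The field with \<open>q\<close> elements is realised as the residue field of \<open>\<int>[\<zeta>]\<close>, with \<open>\<zeta>\<close> a primitive
  \<open>(q - 1)\<close>-th root of unity, at a prime ideal containing \<open>p\<close>: since \<open>x ^ q \<equiv> x\<close> for all \<open>x\<close>, the
  elements \<open>0\<close> and \<open>\<zeta> ^ i\<close> represent all residue classes, and the quadratic character is
  \<open>\<zeta> ^ i \<mapsto> (- 1) ^ i\<close>.\<close>

section \<open>Frames from Hermitian conference matrices\<close>

text \<open>Instances are the identity on the reals and \<open>cnj\<close> on the complex numbers,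
  so the Gram matrix argument is carried out once for both fields.\<close>

locale conjugation =
  fixes cj :: "'e::real_normed_field \<Rightarrow> 'e"
  assumes cj_add: "cj (x + y) = cj x + cj y"
    and cj_mult: "cj (x * y) = cj x * cj y"
    and cj_cj: "cj (cj x) = x"
    and cj_of_real: "cj (of_real r) = of_real r"
    and mult_cj: "x * cj x = of_real ((norm x)\<^sup>2)"
begin

lemma cj_0: "cj 0 = 0"
  using cj_of_real[of 0] by simp

lemma cj_sum: "cj (sum g A) = (\<Sum>x\<in>A. cj (g x))"
  by (induction A rule: infinite_finite_induct) (simp_all add: cj_0 cj_add)

lemma cj_minus: "cj (- x) = - cj x"
proof -
  have "cj x + cj (- x) = 0"
    by (simp flip: cj_add add: cj_0)
  then show ?thesis
    by (simp add: eq_neg_iff_add_eq_0 add.commute)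
qed

lemma cj_diff: "cj (x - y) = cj x - cj y"
  using cj_add[of x "- y"] by (simp add: cj_minus)

lemma cj_divide_of_real: "cj (x / of_real r) = cj x / of_real r"
  using cj_mult[of x "of_real (inverse r)"] by (simp only: cj_of_real) (simp add: divide_inverse)

text \<open>The spectral theorem for a projection, by induction on the rank \<open>card J\<close>: a
  nonzero column of \<open>P\<close> lies in its range; normalise it, subtract its rank-one
  projection, and continue with the rest. The \<open>u a\<close> form an orthonormal basis of the
  range.\<close>

lemma hermitian_idempotent_factorization:
  fixes P :: "'a \<Rightarrow> 'a \<Rightarrow> 'e"
  assumes "finite J" and I: "finite I"
    and herm: "\<And>i k. i \<in> I \<Longrightarrow> k \<in> I \<Longrightarrow> P k i = cj (P i k)"
    and idem: "\<And>i k. i \<in> I \<Longrightarrow> k \<in> I \<Longrightarrow> (\<Sum>j\<in>I. P i j * P j k) = P i k"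
    and trace: "(\<Sum>i\<in>I. P i i) = of_nat (card J)"
  shows "\<exists>u. (\<forall>i\<in>I. \<forall>k\<in>I. P i k = (\<Sum>a\<in>J. u a i * cj (u a k))) \<and>
    (\<forall>a\<in>J. \<forall>b\<in>J. (\<Sum>i\<in>I. u a i * cj (u b i)) = (if a = b then 1 else 0))"
  using assms(1,3-)
proof (induction J arbitrary: P rule: finite_induct)
  case empty
  \<comment> \<open>A diagonal entry of a Hermitian idempotent is the squared norm of its row, so
    trace zero forces \<open>P\<close> to vanish on \<open>I\<close>.\<close>
  have "P i i = of_real (\<Sum>j\<in>I. (norm (P i j))\<^sup>2)" if "i \<in> I" for i
  proof -
    have "P i i = (\<Sum>j\<in>I. P i j * P j i)"
      using empty.prems(2)[OF that that] by simp
    also have "\<dots> = (\<Sum>j\<in>I. P i j * cj (P i j))"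
      using empty.prems(1)[OF that] by (intro sum.cong) auto
    finally show ?thesis by (simp add: mult_cj)
  qed
  then have "of_real (\<Sum>i\<in>I. \<Sum>j\<in>I. (norm (P i j))\<^sup>2) = (0 :: 'e)"
    using empty.prems(3) by simp
  then have "(\<Sum>i\<in>I. \<Sum>j\<in>I. (norm (P i j))\<^sup>2) = 0"
    by (simp only: of_real_eq_0_iff)
  then have "\<forall>i\<in>I. \<forall>j\<in>I. P i j = 0"
    using I by (simp add: sum_nonneg_eq_0_iff sum_nonneg)
  then show ?case by simp
next
  case (insert a J)
  note herm = insert.prems(1) and idem = insert.prems(2)
  have "(\<Sum>i\<in>I. P i i) \<noteq> 0"
    using insert.prems(3) insert.hyps
    by (metis card_insert_disjoint of_nat_eq_0_iff nat.distinct(2))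
  then obtain r where r: "r \<in> I" "P r r \<noteq> 0"
    using sum.neutral[of I "\<lambda>i. P i i"] by blast
  define d where "d = (\<Sum>j\<in>I. (norm (P r j))\<^sup>2)"
  have Prr: "P r r = of_real d"
  proof -
    have "P r r = (\<Sum>j\<in>I. P r j * P j r)"
      using idem[OF r(1) r(1)] by simp
    also have "\<dots> = (\<Sum>j\<in>I. P r j * cj (P r j))"
      using herm[OF r(1)] by (intro sum.cong) auto
    finally show ?thesis by (simp add: mult_cj d_def)
  qed
  have "d \<ge> 0" unfolding d_def by (simp add: sum_nonneg)
  with Prr r(2) have d: "d > 0" by (cases "d = 0") auto
  have dd: "of_real (sqrt d) * of_real (sqrt d) = (of_real d :: 'e)"
    using d by (simp flip: of_real_mult)
  \<comment> \<open>The normalised column \<open>r\<close>: idempotence makes its squared length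
    \<open>d = P r r\<close>, and also makes \<open>P\<close> fix it.\<close>
  define w where "w i = P i r / of_real (sqrt d)" for i
  have cjw: "cj (w i) = P r i / of_real (sqrt d)" if "i \<in> I" for i
    unfolding w_def cj_divide_of_real using herm[OF that r(1)] by (simp only:)
  have Pw: "(\<Sum>j\<in>I. P i j * w j) = w i" if "i \<in> I" for i
    using idem[OF that r(1)] by (simp add: w_def flip: sum_divide_distrib)
  have wP: "(\<Sum>j\<in>I. cj (w j) * P j k) = cj (w k)" if "k \<in> I" for k
    using idem[OF r(1) that] that by (simp add: cjw flip: sum_divide_distrib)
  have ww: "(\<Sum>j\<in>I. cj (w j) * w j) = 1"
  proof -
    have "(\<Sum>j\<in>I. cj (w j) * w j) = (\<Sum>j\<in>I. P r j * P j r) / of_real d"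
      unfolding sum_divide_distrib
    proof (rule sum.cong)
      fix j assume "j \<in> I"
      then show "cj (w j) * w j = P r j * P j r / of_real d"
        by (simp only: cjw) (simp add: w_def flip: dd)
    qed simp
    then show ?thesis using idem[OF r(1) r(1)] Prr d by simp
  qed
  \<comment> \<open>Deflation: \<open>P'\<close> projects onto the orthogonal complement of
    \<open>w\<close> in the range of \<open>P\<close>, so its trace is smaller by one.\<close>
  define P' where "P' i k = P i k - w i * cj (w k)" for i k
  have "\<exists>u. (\<forall>i\<in>I. \<forall>k\<in>I. P' i k = (\<Sum>a\<in>J. u a i * cj (u a k))) \<and>
    (\<forall>a\<in>J. \<forall>b\<in>J. (\<Sum>i\<in>I. u a i * cj (u b i)) = (if a = b then 1 else 0))"
  proof (rule insert.IH)
    show "P' k i = cj (P' i k)" if "i \<in> I" "k \<in> I" for i k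
      unfolding P'_def cj_diff cj_mult cj_cj herm[OF that] by (simp add: mult.commute)
    show "(\<Sum>j\<in>I. P' i j * P' j k) = P' i k" if "i \<in> I" "k \<in> I" for i k
    proof -
      have "(\<Sum>j\<in>I. P' i j * P' j k) = (\<Sum>j\<in>I. P i j * P j k) - (\<Sum>j\<in>I. P i j * w j) * cj (w k)
          - w i * (\<Sum>j\<in>I. cj (w j) * P j k) + w i * (\<Sum>j\<in>I. cj (w j) * w j) * cj (w k)"
        unfolding P'_def sum_distrib_left sum_distrib_right
        by (simp add: algebra_simps sum.distrib sum_subtractf)
      then show ?thesis
        by (simp add: idem Pw wP ww that P'_def)
    qed
    show "(\<Sum>i\<in>I. P' i i) = of_nat (card J)"
      using insert.prems(3) insert.hyps ww
      by (simp add: P'_def sum_subtractf mult.commute)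
  qed
  then obtain u where u: "\<And>i k. i \<in> I \<Longrightarrow> k \<in> I \<Longrightarrow> P' i k = (\<Sum>a\<in>J. u a i * cj (u a k))"
    and orth: "\<And>a b. a \<in> J \<Longrightarrow> b \<in> J \<Longrightarrow>
      (\<Sum>i\<in>I. u a i * cj (u b i)) = (if a = b then 1 else 0)"
    by blast
  \<comment> \<open>Since \<open>P'\<close> annihilates \<open>w\<close>, expanding
    \<open>P' w\<close> in the orthonormal vectors \<open>u a\<close> and pairing with
    \<open>u b\<close> isolates the coefficient of \<open>w\<close> along
    \<open>u b\<close>.\<close>
  have wu: "(\<Sum>i\<in>I. w i * cj (u b i)) = 0" if b: "b \<in> J" for b
  proof -
    have P'w: "(\<Sum>k\<in>I. P' i k * w k) = 0" if "i \<in> I" for i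
    proof -
      have "(\<Sum>k\<in>I. P' i k * w k) = (\<Sum>k\<in>I. P i k * w k) - w i * (\<Sum>k\<in>I. cj (w k) * w k)"
        by (simp add: P'_def sum_distrib_left sum_subtractf algebra_simps)
      then show ?thesis by (simp add: Pw ww that)
    qed
    have "0 = (\<Sum>i\<in>I. cj (u b i) * (\<Sum>k\<in>I. P' i k * w k))"
      using P'w by simp
    also have "\<dots> = (\<Sum>i\<in>I. \<Sum>k\<in>I. \<Sum>a\<in>J. u a i * cj (u b i) * (cj (u a k) * w k))"
      by (simp add: u sum_distrib_left sum_distrib_right mult_ac)
    also have "\<dots> = (\<Sum>a\<in>J. \<Sum>i\<in>I. \<Sum>k\<in>I. u a i * cj (u b i) * (cj (u a k) * w k))"
      by (subst (2) sum.swap, subst sum.swap) (rule refl)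
    also have "\<dots> = (\<Sum>a\<in>J. (\<Sum>i\<in>I. u a i * cj (u b i)) * (\<Sum>k\<in>I. cj (u a k) * w k))"
      by (simp add: sum_product)
    also have "\<dots> = (\<Sum>a\<in>J. if a = b then (\<Sum>k\<in>I. cj (u a k) * w k) else 0)"
      by (rule sum.cong) (simp_all add: orth b)
    also have "\<dots> = (\<Sum>k\<in>I. cj (u b k) * w k)"
      using insert.hyps(1) b by simp
    finally show ?thesis by (simp add: mult.commute)
  qed
  have uw: "(\<Sum>i\<in>I. u b i * cj (w i)) = 0" if b: "b \<in> J" for b
    using arg_cong[OF wu[OF b], of cj] by (simp add: cj_sum cj_mult cj_cj cj_0 mult.commute)
  have "(\<forall>i\<in>I. \<forall>k\<in>I. P i k = (\<Sum>b\<in>insert a J. (u(a := w)) b i * cj ((u(a := w)) b k)))"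
  proof (intro ballI)
    fix i k assume ik: "i \<in> I" "k \<in> I"
    have "(\<Sum>b\<in>J. (u(a := w)) b i * cj ((u(a := w)) b k)) = (\<Sum>b\<in>J. u b i * cj (u b k))"
      using insert.hyps(2) by (intro sum.cong) auto
    then show "P i k = (\<Sum>b\<in>insert a J. (u(a := w)) b i * cj ((u(a := w)) b k))"
      using insert.hyps u[OF ik] by (simp add: P'_def algebra_simps)
  qed
  moreover have "\<forall>b\<in>insert a J. \<forall>c\<in>insert a J.
      (\<Sum>i\<in>I. (u(a := w)) b i * cj ((u(a := w)) c i)) = (if b = c then 1 else 0)"
    using insert.hyps(2) ww wu uw orth by (auto simp: mult.commute)
  ultimately show ?case by blast
qed

text \<open>The factorization of \<open>P\<close> gives vectors with Gram matrix \<open>2 P\<close>.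
  Orthonormality of the \<open>u a\<close> makes them a tight frame, and all off-diagonal Gram
  entries have modulus \<open>1 / s\<close>.\<close>

lemma hermitian_conference_imp_frame:
  fixes Q :: "'a \<Rightarrow> 'a \<Rightarrow> 'e" and ip :: "'e ^ 'm::finite \<Rightarrow> 'e ^ 'm \<Rightarrow> 'e"
  assumes ip: "\<And>x y. ip x y = (\<Sum>i\<in>UNIV. x $ i * cj (y $ i))"
    and I: "finite I" "card I = 2 * CARD('m)"
    and herm: "\<And>i k. i \<in> I \<Longrightarrow> k \<in> I \<Longrightarrow> Q k i = cj (Q i k)"
    and diag: "\<And>i. i \<in> I \<Longrightarrow> Q i i = 0"
    and off: "\<And>i k. i \<in> I \<Longrightarrow> k \<in> I \<Longrightarrow> i \<noteq> k \<Longrightarrow> norm (Q i k) = 1"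
    and square: "\<And>i k. i \<in> I \<Longrightarrow> k \<in> I \<Longrightarrow>
      (\<Sum>j\<in>I. Q i j * Q j k) = (if i = k then of_nat (card I - 1) else 0)"
  shows "\<exists>f. optimal_grassmannian_frame ip (2 * CARD('m)) f"
proof -
  define s where "s = sqrt (real (card I) - 1)"
  have "CARD('m) > 0" by simp
  then have m: "real CARD('m) \<ge> 1" by linarith
  have N: "real (card I) > 1" using m unfolding I(2) of_nat_mult by linarith
  have s: "s > 0" "s\<^sup>2 = real (card I - 1)"
    using N I(2) by (simp_all add: s_def)
  have ss: "of_real s * of_real s = (of_nat (card I - 1) :: 'e)"
    using s(2) by (simp add: power2_eq_square flip: of_real_mult)
  define E :: "'a \<Rightarrow> 'a \<Rightarrow> 'e" where "E i k = (if i = k then 1 else 0)" for i k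
  \<comment> \<open>As \<open>Q\<close> squares to \<open>s\<^sup>2\<close> times the identity, this
    is its spectral projection for the eigenvalue \<open>s\<close>; the zero diagonal of
    \<open>Q\<close> gives it trace half of \<open>card I\<close>.\<close>
  define P where "P i k = (E i k + Q i k / of_real s) / 2" for i k
  have "\<exists>u. (\<forall>i\<in>I. \<forall>k\<in>I. P i k = (\<Sum>a\<in>(UNIV::'m set). u a i * cj (u a k))) \<and>
    (\<forall>a\<in>UNIV. \<forall>b\<in>UNIV. (\<Sum>i\<in>I. u a i * cj (u b i)) = (if a = b then 1 else 0))"
  proof (rule hermitian_idempotent_factorization)
    show "P k i = cj (P i k)" if "i \<in> I" "k \<in> I" for i k
    proof -
      have "cj (x / 2) = cj x / 2" for x using cj_divide_of_real[of x 2] by simp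
      moreover have "cj (E i k) = E k i" using cj_of_real[of 1] by (auto simp: E_def cj_0)
      ultimately show ?thesis
        unfolding P_def by (simp only: cj_add cj_divide_of_real herm[OF that])
    qed
    show "(\<Sum>j\<in>I. P i j * P j k) = P i k" if ik: "i \<in> I" "k \<in> I" for i k
    proof -
      have QQ: "(\<Sum>j\<in>I. Q i j * Q j k) / (of_real s * of_real s) = E i k"
        unfolding square[OF ik] ss[symmetric] using s(1) by (simp add: E_def)
      have "(\<Sum>j\<in>I. P i j * P j k) = ((\<Sum>j\<in>I. E i j * E j k) + (\<Sum>j\<in>I. E i j * Q j k) / of_real s
          + (\<Sum>j\<in>I. Q i j * E j k) / of_real s
          + (\<Sum>j\<in>I. Q i j * Q j k) / (of_real s * of_real s)) / 4"
        unfolding P_def sum_divide_distrib sum.distrib[symmetric]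
        using s(1) by (intro sum.cong) (simp_all add: field_simps)
      also have "\<dots> = (E i k + Q i k / of_real s + Q i k / of_real s + E i k) / 4"
        unfolding QQ using ik I(1) by (simp add: E_def if_distrib[of "\<lambda>x. x * _"]
          if_distrib[of "\<lambda>x. _ * x"] cong: if_cong)
      also have "\<dots> = P i k"
        by (simp add: P_def field_simps)
      finally show ?thesis .
    qed
    have "(\<Sum>i\<in>I. P i i) = of_nat (card I) / 2"
      by (simp add: P_def E_def diag)
    then show "(\<Sum>i\<in>I. P i i) = of_nat CARD('m)"
      by (simp add: I(2))
  qed (use I in auto)
  then obtain u where u: "\<And>i k. i \<in> I \<Longrightarrow> k \<in> I \<Longrightarrow> P i k = (\<Sum>a\<in>(UNIV::'m set). u a i * cj (u a k))"
    and orth: "\<And>a b. (\<Sum>i\<in>I. u a i * cj (u b i)) = (if a = b then 1 else 0)"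
    by blast
  obtain h where h: "bij_betw h {1..2 * CARD('m)} I"
    using I by (metis card_atLeastAtMost diff_Suc_1 finite_atLeastAtMost finite_same_card_bij)
  \<comment> \<open>The diagonal of \<open>P\<close> is constantly 1/2, so the factor
    \<open>sqrt 2\<close> produces unit vectors.\<close>
  define g :: "'a \<Rightarrow> 'e ^ 'm" where "g i = (\<chi> a. of_real (sqrt 2) * u a i)" for i
  define f where "f = g \<circ> h"
  have two: "of_real (sqrt 2) * of_real (sqrt 2) = (2 :: 'e)"
    by (simp flip: of_real_mult)
  have gram: "ip (g i) (g k) = E i k + Q i k / of_real s" if "i \<in> I" "k \<in> I" for i k
  proof -
    have "ip (g i) (g k) = (of_real (sqrt 2) * of_real (sqrt 2)) * P i k"
      unfolding u[OF that] by (simp add: ip g_def cj_mult cj_of_real sum_distrib_left mult_ac)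
    also have "\<dots> = E i k + Q i k / of_real s"
      by (simp add: two P_def)
    finally show ?thesis .
  qed
  have ip_self: "ip x x = of_real ((norm x)\<^sup>2)" for x
    by (simp add: ip mult_cj norm_vec_def L2_set_def sum_nonneg)
  have unit: "norm (g i) = 1" if "i \<in> I" for i
  proof -
    have "of_real ((norm (g i))\<^sup>2) = (of_real 1 :: 'e)"
      using gram[OF that that] diag[OF that] by (simp add: ip_self E_def del: of_real_power)
    then have "(norm (g i))\<^sup>2 = 1"
      by (simp only: of_real_eq_iff)
    then show ?thesis
      using norm_ge_zero[of "g i"] unfolding power2_eq_1_iff by linarith
  qed
  \<comment> \<open>Parseval for the orthonormal \<open>u a\<close>, scaled by 2; both frame bounds
    are therefore 2.\<close>
  have tight: "(\<Sum>i\<in>I. (norm (ip v (g i)))\<^sup>2) = 2 * (norm v)\<^sup>2" for v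
  proof -
    have "of_real (\<Sum>i\<in>I. (norm (ip v (g i)))\<^sup>2) = (\<Sum>i\<in>I. ip v (g i) * cj (ip v (g i)))"
      by (simp add: mult_cj)
    also have "\<dots> = (\<Sum>i\<in>I. \<Sum>b\<in>UNIV. \<Sum>a\<in>UNIV. 2 * (v $ b * cj (v $ a) * (u a i * cj (u b i))))"
      unfolding ip g_def cj_sum sum_product two[symmetric]
      by (simp add: cj_mult cj_of_real cj_cj mult_ac)
    also have "\<dots> = (\<Sum>b\<in>UNIV. \<Sum>a\<in>UNIV. \<Sum>i\<in>I. 2 * (v $ b * cj (v $ a) * (u a i * cj (u b i))))"
      by (subst sum.swap, subst (2) sum.swap) (rule refl)
    also have "\<dots> = (\<Sum>b\<in>UNIV. \<Sum>a\<in>UNIV. 2 * (v $ b * cj (v $ a) * (if a = b then 1 else 0)))"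
      by (simp add: orth flip: sum_distrib_left)
    also have "\<dots> = 2 * ip v v"
      by (simp add: ip sum_distrib_left if_distrib[of "\<lambda>x. _ * x"] cong: if_cong)
    also have "\<dots> = of_real (2 * (norm v)\<^sup>2)"
      by (simp add: ip_self)
    finally show ?thesis by (simp only: of_real_eq_iff)
  qed
  have "(\<Sum>k=1..2 * CARD('m). (norm (ip v (f k)))\<^sup>2) = 2 * (norm v)\<^sup>2" for v
    using sum.reindex_bij_betw[OF h, of "\<lambda>i. (norm (ip v (g i)))\<^sup>2"] tight by (simp add: f_def)
  then have "is_frame ip (2 * CARD('m)) f"
    unfolding is_frame_def by (intro exI[of _ 2]) simp
  moreover have hI: "h k \<in> I" if "k \<in> {1..2 * CARD('m)}" for k
    using h that by (auto simp: bij_betw_def)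
  ultimately have "uniform_frame ip (2 * CARD('m)) f"
    unfolding uniform_frame_def using unit by (auto simp: f_def)
  moreover have corr: "norm (ip (f k) (f l)) = 1 / s"
    if "k \<in> {1..2 * CARD('m)}" "l \<in> {1..2 * CARD('m)}" "k \<noteq> l" for k l
  proof -
    have "h k \<noteq> h l"
      using inj_on_eq_iff[OF bij_betw_imp_inj_on[OF h] that(1,2)] that(3) by simp
    then show ?thesis
      using gram[OF hI hI, OF that(1,2)] off[OF hI hI, OF that(1,2)] s
      by (simp add: f_def E_def norm_divide)
  qed
  \<comment> \<open>The maximum is taken over a singleton; the pair 1, 2 shows that the set is
    nonempty.\<close>
  have "{norm (ip (f k) (f l)) |k l. k \<in> {1..2 * CARD('m)} \<and> l \<in> {1..2 * CARD('m)} \<and> k \<noteq> l}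
      = {1 / s}" (is "?S = _")
  proof (intro equalityI subsetI)
    fix x assume "x \<in> ?S"
    then show "x \<in> {1 / s}" using corr by auto
  next
    fix x assume "x \<in> {1 / s}"
    moreover have "norm (ip (f 1) (f 2)) \<in> ?S"
      using m by (intro CollectI exI[of _ 1] exI[of _ 2]) auto
    ultimately show "x \<in> ?S" using corr[of 1 2] m by simp
  qed
  then have "max_correlation ip (2 * CARD('m)) f = 1 / s"
    by (simp add: max_correlation_def)
  moreover have "(real (2 * CARD('m)) - real CARD('m)) / (real CARD('m) * (real (2 * CARD('m)) - 1))
      = 1 / (real (card I) - 1)"
  proof -
    have *: "real (2 * CARD('m)) - real CARD('m) = real CARD('m)" by simp
    show ?thesis unfolding I(2) * using m by (simp del: of_nat_mult)
  qed
  ultimately have "optimal_grassmannian_frame ip (2 * CARD('m)) f"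
    unfolding optimal_grassmannian_frame_def s_def by (simp only: real_sqrt_divide real_sqrt_one)
  then show ?thesis by (rule exI[of _ f])
qed

end

section \<open>Skew conference matrices\<close>

text \<open>Orthogonality is required of rows, so that symmetric and skew matrices fall under the
  same notion.\<close>

definition conference_matrix :: "'a set \<Rightarrow> ('a \<Rightarrow> 'a \<Rightarrow> int) \<Rightarrow> bool" where
  "conference_matrix I C \<longleftrightarrow> finite I \<and> (\<forall>i\<in>I. C i i = 0) \<and>
     (\<forall>i\<in>I. \<forall>k\<in>I. i \<noteq> k \<longrightarrow> \<bar>C i k\<bar> = 1) \<and>
     (\<forall>i\<in>I. \<forall>k\<in>I. (\<Sum>j\<in>I. C i j * C k j) = (if i = k then int (card I) - 1 else 0))"

lemma symmetric_conference_imp_real_frame: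
  assumes C: "conference_matrix I C" and sym: "\<And>i k. i \<in> I \<Longrightarrow> k \<in> I \<Longrightarrow> C k i = C i k"
    and card: "card I = 2 * CARD('m::finite)"
  shows "\<exists>f :: nat \<Rightarrow> real ^ 'm. optimal_grassmannian_frame inner (2 * CARD('m)) f"
proof -
  interpret conjugation "\<lambda>x::real. x"
    by unfold_locales (simp_all add: power2_eq_square)
  show ?thesis
  proof (rule hermitian_conference_imp_frame[where Q = "\<lambda>i k. real_of_int (C i k)"])
    show "(\<Sum>j\<in>I. real_of_int (C i j) * real_of_int (C j k))
        = (if i = k then of_nat (card I - 1) else 0)" if ik: "i \<in> I" "k \<in> I" for i k
    proof -
      have "card I \<ge> 1" using zero_less_card_finite[where 'a = 'm] card by linarith
      have "(\<Sum>j\<in>I. real_of_int (C i j) * real_of_int (C j k))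
          = real_of_int (\<Sum>j\<in>I. C i j * C k j)"
        using ik sym by simp
      also have "(\<Sum>j\<in>I. C i j * C k j) = (if i = k then int (card I) - 1 else 0)"
        using C ik by (simp add: conference_matrix_def)
      finally show ?thesis
        using \<open>card I \<ge> 1\<close> by simp
    qed
  qed (use C sym card in \<open>auto simp: conference_matrix_def inner_vec_def simp flip: of_int_abs\<close>)
qed

text \<open>Multiplication by \<open>\<i>\<close> makes a real skew matrix Hermitian, and the sign
  from \<open>\<i> * \<i>\<close> cancels the one from transposing \<open>C\<close>.\<close>

lemma skew_conference_imp_complex_frame:
  assumes C: "conference_matrix I C" and skew: "\<And>i k. i \<in> I \<Longrightarrow> k \<in> I \<Longrightarrow> C k i = - C i k"
    and card: "card I = 2 * CARD('m::finite)"
  shows "\<exists>f :: nat \<Rightarrow> complex ^ 'm. optimal_grassmannian_frame hermitian_inner (2 * CARD('m)) f"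
proof -
  interpret conjugation cnj
    by unfold_locales (simp_all add: complex_norm_square del: of_real_power)
  show ?thesis
  proof (rule hermitian_conference_imp_frame[where Q = "\<lambda>i k. \<i> * of_int (C i k)"])
    show "(\<Sum>j\<in>I. (\<i> * of_int (C i j)) * (\<i> * of_int (C j k)))
        = (if i = k then of_nat (card I - 1) else (0::complex))" if ik: "i \<in> I" "k \<in> I" for i k
    proof -
      have "card I \<ge> 1" using zero_less_card_finite[where 'a = 'm] card by linarith
      have "(\<Sum>j\<in>I. (\<i> * of_int (C i j)) * (\<i> * of_int (C j k)))
          = (\<Sum>j\<in>I. complex_of_int (C i j * C k j))"
      proof (rule sum.cong)
        fix j assume "j \<in> I"
        then show "(\<i> * of_int (C i j)) * (\<i> * of_int (C j k)) = complex_of_int (C i j * C k j)"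
          using skew[of k j] ik(2) by (simp add: mult_ac flip: mult.assoc[of \<i> \<i>])
      qed simp
      also have "\<dots> = complex_of_int (\<Sum>j\<in>I. C i j * C k j)" by simp
      also have "(\<Sum>j\<in>I. C i j * C k j) = (if i = k then int (card I) - 1 else 0)"
        using C ik by (simp add: conference_matrix_def)
      finally show ?thesis
        using \<open>card I \<ge> 1\<close> by simp
    qed
  next
    fix i k assume "i \<in> I" "k \<in> I"
    then show "\<i> * of_int (C k i) = cnj (\<i> * of_int (C i k))"
      using skew[of i k] by simp
  qed (use C card in \<open>auto simp: conference_matrix_def hermitian_inner_def norm_mult simp flip: of_int_abs\<close>)
qed

text \<open>The doubling \<open>C \<mapsto> [[C, C + I], [C - I, -C]]\<close>, starting from the \<open>1 \<times> 1\<close> zero matrix.\<close>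

fun skew_conference :: "bool list \<Rightarrow> bool list \<Rightarrow> int" where
  "skew_conference (a # x) (b # y) =
     (if a = b then (if a then - skew_conference x y else skew_conference x y)
      else skew_conference x y + (if x = y then if a then - 1 else 1 else 0))"
| "skew_conference _ _ = 0"

lemma skew_conference_commute:
  "length x = length y \<Longrightarrow> skew_conference y x = - skew_conference x y"
  by (induction x y rule: list_induct2) auto

text \<open>Multiply the doubled block matrix by its transpose. As the transpose of \<open>C\<close>
  is \<open>- C\<close>, the linear terms cancel: off-diagonal blocks vanish, and diagonal blocks
  are twice the old product plus the identity.\<close>

lemma conference_matrix_skew_conference:
  "conference_matrix {x. length x = n} skew_conference"
proof (induction n)
  case 0
  then show ?case by (simp add: conference_matrix_def)
next
  case (Suc n)
  let ?L = "{x :: bool list. length x = n}"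
  have fin: "finite ?L" and diag: "\<And>x. x \<in> ?L \<Longrightarrow> skew_conference x x = 0"
    and off: "\<And>x y. x \<in> ?L \<Longrightarrow> y \<in> ?L \<Longrightarrow> x \<noteq> y \<Longrightarrow> \<bar>skew_conference x y\<bar> = 1"
    and prod: "\<And>x y. x \<in> ?L \<Longrightarrow> y \<in> ?L \<Longrightarrow>
      (\<Sum>z\<in>?L. skew_conference x z * skew_conference y z) = (if x = y then int (card ?L) - 1 else 0)"
    using Suc by (auto simp: conference_matrix_def)
  have split: "{x :: bool list. length x = Suc n} = Cons False ` ?L \<union> Cons True ` ?L"
    by (auto simp: length_Suc_conv image_iff)
  have card: "card {x :: bool list. length x = Suc n} = 2 * card ?L"
    unfolding split using fin by (subst card_Un_disjoint) (auto simp: card_image)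
  have sum: "sum g {x :: bool list. length x = Suc n}
      = (\<Sum>z\<in>?L. g (False # z)) + (\<Sum>z\<in>?L. g (True # z))" for g :: "bool list \<Rightarrow> int"
    unfolding split using fin by (subst sum.union_disjoint) (auto simp: sum.reindex)
  \<comment> \<open>A Kronecker delta kept opaque lets all four block products expand without case
    splits on list equality.\<close>
  define \<delta> :: "bool list \<Rightarrow> bool list \<Rightarrow> int" where "\<delta> x y = (if x = y then 1 else 0)" for x y
  have rec: "skew_conference (a # x) (b # y) =
     (if a = b then (if a then - skew_conference x y else skew_conference x y)
      else skew_conference x y + (if a then - \<delta> x y else \<delta> x y))" for a b x y
    by (simp add: \<delta>_def)
  have delta: "(\<Sum>z\<in>?L. \<delta> x z * g z) = g x" "(\<Sum>z\<in>?L. g z * \<delta> x z) = g x" if "x \<in> ?L" for x g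
    using fin that by (simp_all add: \<delta>_def if_distrib[of "\<lambda>c. c * _"] if_distrib[of "\<lambda>c. _ * c"] cong: if_cong)
  have "(\<Sum>z | length z = Suc n. skew_conference (a # x) z * skew_conference (b # y) z)
      = (if a # x = b # y then int (2 * card ?L) - 1 else 0)"
    if xy: "x \<in> ?L" "y \<in> ?L" for a b x y
  proof -
    have comm: "skew_conference y x = - skew_conference x y"
      using skew_conference_commute[of x y] xy by simp
    have [simp]: "\<delta> y x = \<delta> x y"
      by (simp add: \<delta>_def)
    have prod': "(\<Sum>z\<in>?L. skew_conference x z * skew_conference y z)
        = int (card ?L) * \<delta> x y - \<delta> x y"
      using prod[OF xy] by (simp add: \<delta>_def)
    have "(\<Sum>z | length z = Suc n. skew_conference (a # x) z * skew_conference (b # y) z)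
        = (if a = b then (2 * int (card ?L) - 1) * \<delta> x y else 0)"
      unfolding sum rec
      by (cases a; cases b)
         (simp_all add: algebra_simps sum.distrib sum_subtractf sum_negf
           delta[OF xy(1)] delta[OF xy(2)] prod' comm)
    then show ?thesis by (simp add: \<delta>_def)
  qed
  then have "\<forall>x\<in>{x. length x = Suc n}. \<forall>y\<in>{x. length x = Suc n}.
      (\<Sum>z | length z = Suc n. skew_conference x z * skew_conference y z)
      = (if x = y then int (2 * card ?L) - 1 else 0)"
    unfolding split by blast
  moreover have "finite {x :: bool list. length x = Suc n}"
    unfolding split using fin by simp
  moreover have "skew_conference (a # x) (a # x) = 0" if "x \<in> ?L" for a x
    using diag[OF that] by simp
  then have "\<forall>x\<in>{x. length x = Suc n}. skew_conference x x = 0"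
    unfolding split by blast
  moreover have "\<bar>skew_conference (a # x) (b # y)\<bar> = 1"
    if "x \<in> ?L" "y \<in> ?L" "a # x \<noteq> b # y" for a b x y
    using diag[OF that(1)] off[OF that(1,2)] that(3) by (cases "x = y") auto
  then have "\<forall>x\<in>{x. length x = Suc n}. \<forall>y\<in>{x. length x = Suc n}.
      x \<noteq> y \<longrightarrow> \<bar>skew_conference x y\<bar> = 1"
    unfolding split by blast
  ultimately show ?case
    unfolding conference_matrix_def card by blast
qed

lemma card_bool_lists: "card {x :: bool list. length x = n} = 2 ^ n"
  using card_lists_length_eq[of "UNIV :: bool set" n] by simp

section \<open>The Paley conference matrix\<close>

lemma power_mod_order:
  fixes z :: "'a::monoid_mult"
  assumes "z ^ n = 1" shows "z ^ (k mod n) = z ^ k"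
proof -
  have "z ^ k = z ^ (n * (k div n) + k mod n)" by simp
  then show ?thesis by (simp only: power_add power_mult assms power_one mult_1)
qed

text \<open>\<open>R\<close> modulo \<open>M\<close> is a field with \<open>n + 1\<close> elements,
  handled through congruences instead of a quotient type; \<open>z\<close> generates its
  multiplicative group.\<close>

locale residue_field =
  fixes R M :: "'a::comm_ring_1 set" and z :: 'a and n :: nat
  assumes one_R: "1 \<in> R" and diff_R: "x \<in> R \<Longrightarrow> y \<in> R \<Longrightarrow> x - y \<in> R"
    and mult_R: "x \<in> R \<Longrightarrow> y \<in> R \<Longrightarrow> x * y \<in> R" and z_R: "z \<in> R"
    and zero_M: "0 \<in> M" and diff_M: "x \<in> M \<Longrightarrow> y \<in> M \<Longrightarrow> x - y \<in> M"
    and mult_M: "x \<in> R \<Longrightarrow> y \<in> M \<Longrightarrow> x * y \<in> M" and one_notin_M: "1 \<notin> M"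
    and z_power: "z ^ n = 1" and n_pos: "0 < n" and four_dvd: "4 dvd n"
    and distinct: "i < n \<Longrightarrow> j < n \<Longrightarrow> z ^ i - z ^ j \<in> M \<Longrightarrow> i = j"
    and cover: "x \<in> R \<Longrightarrow> x \<notin> M \<Longrightarrow> \<exists>i<n. x - z ^ i \<in> M"
begin

section \<open>Congruence modulo \<open>M\<close>\<close>

lemma zero_R: "0 \<in> R"
  using diff_R[OF one_R one_R] by simp

lemma add_R: "x \<in> R \<Longrightarrow> y \<in> R \<Longrightarrow> x + y \<in> R"
  using diff_R[OF _ diff_R[OF zero_R], of x y] by simp

lemma power_R: "z ^ i \<in> R"
  by (induction i) (simp_all add: one_R mult_R z_R)

lemma minus_M: "x \<in> M \<Longrightarrow> - x \<in> M"
  using diff_M[OF zero_M, of x] by simp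

lemma add_M: "x \<in> M \<Longrightarrow> y \<in> M \<Longrightarrow> x + y \<in> M"
  using diff_M[OF _ minus_M, of x y] by simp

lemma cong_sym: "x - y \<in> M \<Longrightarrow> y - x \<in> M"
  using minus_M[of "x - y"] by simp

lemma cong_trans: "x - y \<in> M \<Longrightarrow> y - w \<in> M \<Longrightarrow> x - w \<in> M"
  using add_M[of "x - y" "y - w"] by simp

lemma cong_mem: "x - y \<in> M \<Longrightarrow> x \<in> M \<longleftrightarrow> y \<in> M"
  using add_M[of "x - y" y] diff_M[of x "x - y"] by auto

lemma z_power_mod: "z ^ (k mod n) = z ^ k"
  by (rule power_mod_order[OF z_power])

lemma z_power_inverse: "i \<le> n \<Longrightarrow> z ^ i * z ^ (n - i) = 1"
  by (simp add: z_power flip: power_add)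

lemma cancel_power:
  assumes "i < n" "x * z ^ i \<in> M" shows "x \<in> M"
proof -
  have "z ^ (n - i) * (x * z ^ i) = x * (z ^ i * z ^ (n - i))"
    by (simp add: mult_ac)
  also have "\<dots> = x"
    using assms(1) by (simp add: z_power_inverse)
  finally show ?thesis
    using mult_M[OF power_R assms(2), of "n - i"] by simp
qed

lemma power_notin_M: "z ^ i \<notin> M"
  using cancel_power[of "i mod n" 1] one_notin_M n_pos by (auto simp: z_power_mod)

text \<open>Modulo \<open>M\<close>, every element of \<open>R\<close> outside \<open>M\<close> is a
  power of \<open>z\<close>, and \<open>z ^ i\<close> has the inverse
  \<open>z ^ (n - i)\<close>.\<close>

lemma cancel:
  assumes "x \<in> R" "b \<in> R" "b \<notin> M" "x * b \<in> M" shows "x \<in> M"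
proof -
  obtain i where i: "i < n" "b - z ^ i \<in> M" using cover assms(2,3) by blast
  have "x * b - x * z ^ i \<in> M"
    using mult_M[OF assms(1) i(2)] by (simp add: right_diff_distrib)
  then show ?thesis using cancel_power[OF i(1)] cong_mem assms(4) by blast
qed

section \<open>The quadratic character\<close>

text \<open>The described exponent is the discrete logarithm of \<open>x\<close> to base
  \<open>z\<close>; for \<open>x\<close> in \<open>R\<close> outside \<open>M\<close> it exists by
  \<open>cover\<close> and is unique by \<open>distinct\<close>.\<close>

definition quadratic_character :: "'a \<Rightarrow> int" ("\<chi>") where
  "\<chi> x = (if x \<in> M then 0 else (- 1) ^ (THE i. i < n \<and> x - z ^ i \<in> M))"

lemma character_cong:
  assumes "x - y \<in> M" shows "\<chi> x = \<chi> y"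
proof -
  have "x - z ^ i \<in> M \<longleftrightarrow> y - z ^ i \<in> M" for i
    using assms cong_sym cong_trans by blast
  then show ?thesis
    using cong_mem[OF assms] by (simp add: quadratic_character_def)
qed

text \<open>Exponents matter only modulo \<open>n\<close>, and \<open>n\<close> is even, so their
  parity is well defined.\<close>

lemma character_power: "\<chi> (z ^ k) = (- 1) ^ k"
proof -
  have "(THE i. i < n \<and> z ^ k - z ^ i \<in> M) = k mod n"
  proof (rule the_equality)
    show "k mod n < n \<and> z ^ k - z ^ (k mod n) \<in> M"
      using n_pos zero_M by (simp add: z_power_mod)
    then show "i = k mod n" if "i < n \<and> z ^ k - z ^ i \<in> M" for i
      using that distinct cong_sym cong_trans by blast
  qed
  moreover have "even n" using four_dvd by presburger
  then have "even (k mod n) \<longleftrightarrow> even k" by (simp add: dvd_mod_iff)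
  then have "(- 1 :: int) ^ (k mod n) = (- 1) ^ k"
    by (simp add: minus_one_power_iff)
  ultimately show ?thesis
    using power_notin_M[of k] by (simp add: quadratic_character_def)
qed

lemma character_zero: "\<chi> x = 0 \<longleftrightarrow> x \<in> M"
  by (simp add: quadratic_character_def)

lemma character_one: "\<chi> 1 = 1"
  using character_power[of 0] by simp

lemma character_square: "x \<notin> M \<Longrightarrow> \<chi> x * \<chi> x = 1" "x \<notin> M \<Longrightarrow> \<bar>\<chi> x\<bar> = 1"
  by (simp_all add: quadratic_character_def power_abs flip: power_mult_distrib)

lemma character_mult:
  assumes "x \<in> R" "y \<in> R" shows "\<chi> (x * y) = \<chi> x * \<chi> y"
proof (cases "x \<in> M \<or> y \<in> M")
  case True
  then have "x * y \<in> M"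
    using mult_M[OF assms(1), of y] mult_M[OF assms(2), of x] by (auto simp: mult.commute)
  then show ?thesis using True by (auto simp: quadratic_character_def)
next
  case False
  then obtain i j where ij: "x - z ^ i \<in> M" "y - z ^ j \<in> M"
    using cover assms by meson
  have "x * (y - z ^ j) + z ^ j * (x - z ^ i) \<in> M"
    by (intro add_M mult_M ij assms power_R)
  then have "x * y - z ^ (i + j) \<in> M"
    by (simp add: algebra_simps power_add)
  then have "\<chi> (x * y) = (- 1) ^ (i + j)"
    using character_cong character_power by metis
  moreover have "\<chi> x = (- 1) ^ i" "\<chi> y = (- 1) ^ j"
    using character_cong character_power ij by metis+
  ultimately show ?thesis by (simp add: power_add)
qed

text \<open>If -1 is congruent to \<open>z ^ k\<close>, then \<open>z ^ (2 * k)\<close> is congruent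
  to 1, hence \<open>n\<close> and so 4 divides \<open>2 * k\<close>, and \<open>k\<close> is even.
  Here \<open>4 dvd n\<close> enters beyond mere evenness of \<open>n\<close>; it makes the Paley
  matrix symmetric.\<close>

lemma character_minus:
  assumes "x \<in> R" shows "\<chi> (- x) = \<chi> x"
proof -
  have m1: "- 1 \<in> R" "- 1 \<notin> M"
    using diff_R[OF zero_R one_R] minus_M[of "- 1"] one_notin_M by auto
  then obtain k where k: "- 1 - z ^ k \<in> M" using cover by blast
  have "- 1 - z ^ k \<in> R" using diff_R m1(1) power_R by blast
  \<comment> \<open>The first factor is chosen so that the product equals
    \<open>1 - z ^ (2 * k)\<close>.\<close>
  then have "(z ^ k - 1) * (- 1 - z ^ k) \<in> M"
    by (intro mult_M k diff_R power_R one_R)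
  then have "z ^ 0 - z ^ (2 * k) \<in> M"
    by (simp add: algebra_simps power_mult power2_eq_square flip: power_mult_distrib)
  then have "z ^ 0 - z ^ (2 * k mod n) \<in> M"
    by (simp only: z_power_mod)
  then have "2 * k mod n = 0"
    using distinct[of 0 "2 * k mod n"] n_pos by simp
  then have "4 dvd 2 * k" using four_dvd by (meson dvd_trans mod_0_imp_dvd)
  then have "even k" by presburger
  then have "\<chi> (- 1) = 1"
    using character_cong[OF k] character_power[of k] by simp
  then show ?thesis
    using character_mult[OF m1(1) assms] by simp
qed

section \<open>Character sums over representatives\<close>

definition transversal :: "'a set" where
  "transversal = insert 0 ((\<lambda>i. z ^ i) ` {..<n})"

lemma inj_power: "inj_on (\<lambda>i. z ^ i) {..<n}"
  using distinct zero_M by (auto simp: inj_on_def)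

lemma zero_not_power: "0 \<notin> (\<lambda>i. z ^ i) ` {..<n}"
  using power_notin_M zero_M by (metis imageE)

lemma finite_transversal: "finite transversal"
  by (simp add: transversal_def)

lemma card_transversal: "card transversal = n + 1"
  using zero_not_power inj_power by (simp add: transversal_def card_image)

lemma transversal_R: "c \<in> transversal \<Longrightarrow> c \<in> R"
  by (auto simp: transversal_def zero_R power_R)

lemma transversal_distinct:
  "c \<in> transversal \<Longrightarrow> d \<in> transversal \<Longrightarrow> c - d \<in> M \<Longrightarrow> c = d"
proof -
  have "- (z ^ i) \<notin> M" for i
    using minus_M[of "- (z ^ i)"] power_notin_M by auto
  then show "c \<in> transversal \<Longrightarrow> d \<in> transversal \<Longrightarrow> c - d \<in> M \<Longrightarrow> c = d"
    using distinct power_notin_M by (auto simp: transversal_def)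
qed

lemma transversal_cover: "x \<in> R \<Longrightarrow> \<exists>c\<in>transversal. x - c \<in> M"
  using cover[of x] by (cases "x \<in> M") (auto simp: transversal_def)

lemma sum_transversal: "sum g transversal = g 0 + (\<Sum>i<n. g (z ^ i))"
  using zero_not_power inj_power by (simp add: transversal_def sum.reindex)

text \<open>A map that is injective on the finitely many classes permutes them, so the sum of a
  function constant on classes is unchanged.\<close>

lemma sum_transversal_reindex:
  fixes g :: "'a \<Rightarrow> int"
  assumes h: "\<And>c. c \<in> transversal \<Longrightarrow> h c \<in> R"
    and inj: "\<And>c d. c \<in> transversal \<Longrightarrow> d \<in> transversal \<Longrightarrow> h c - h d \<in> M \<Longrightarrow> c - d \<in> M"
    and g: "\<And>x y. x \<in> R \<Longrightarrow> y \<in> R \<Longrightarrow> x - y \<in> M \<Longrightarrow> g x = g y"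
  shows "(\<Sum>c\<in>transversal. g (h c)) = sum g transversal"
proof -
  have "\<forall>c\<in>transversal. \<exists>d\<in>transversal. h c - d \<in> M"
    using h transversal_cover by blast
  then obtain r where r: "\<And>c. c \<in> transversal \<Longrightarrow> r c \<in> transversal"
      "\<And>c. c \<in> transversal \<Longrightarrow> h c - r c \<in> M"
    by metis
  have inj_r: "inj_on r transversal"
  proof (rule inj_onI)
    fix c d assume cd: "c \<in> transversal" "d \<in> transversal" "r c = r d"
    have "h c - r c \<in> M" "r c - h d \<in> M"
      using r(2)[OF cd(1)] cong_sym[OF r(2)[OF cd(2)]] cd(3) by auto
    then have "h c - h d \<in> M" by (rule cong_trans)
    then show "c = d" using inj transversal_distinct cd by blast
  qed
  have "r ` transversal = transversal"
    using r(1) by (intro endo_inj_surj finite_transversal inj_r) auto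
  then have "sum g transversal = (\<Sum>c\<in>transversal. g (r c))"
    using sum.reindex[OF inj_r, of g] by simp
  also have "\<dots> = (\<Sum>c\<in>transversal. g (h c))"
    using g h r transversal_R by (intro sum.cong) (auto intro: sym)
  finally show ?thesis by simp
qed

text \<open>Nonzero squares and non-squares are equally many: the signs alternate along the
  \<open>n\<close> powers of \<open>z\<close>.\<close>

lemma sum_character: "sum \<chi> transversal = 0"
proof -
  have "(\<Sum>i<2 * k. (- 1 :: int) ^ i) = 0" for k :: nat
    by (induction k) simp_all
  moreover have "even n" using four_dvd by presburger
  ultimately have "(\<Sum>i<n. (- 1 :: int) ^ i) = 0" by (metis evenE)
  moreover have "\<chi> 0 = 0" using zero_M by (simp add: character_zero)
  ultimately show ?thesis
    by (simp add: sum_transversal character_power)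
qed

lemma sum_character_square: "(\<Sum>c\<in>transversal. \<chi> c * \<chi> c) = int n"
  using zero_M power_notin_M by (simp add: sum_transversal character_square character_zero)

lemma sum_character_affine:
  assumes a: "a \<in> R" and b: "b \<in> R" "b \<notin> M"
  shows "(\<Sum>c\<in>transversal. \<chi> (a + c * b)) = 0"
proof -
  have "(\<Sum>c\<in>transversal. \<chi> (a + c * b)) = sum \<chi> transversal"
  proof (rule sum_transversal_reindex)
    fix c d assume "c \<in> transversal" "d \<in> transversal" "a + c * b - (a + d * b) \<in> M"
    then show "c - d \<in> M"
      using cancel[OF _ b, of "c - d"] diff_R transversal_R by (simp add: left_diff_distrib)
  qed (auto intro: add_R mult_R a b transversal_R character_cong)
  then show ?thesis by (simp add: sum_character)
qed

text \<open>For nonzero \<open>c\<close>, multiplicativity turns the summand into the character of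
  \<open>1 + b / c\<close>. This argument runs through every class except that of 1, so the sum is
  \<open>0 - \<chi> 1\<close>.\<close>

lemma sum_character_shift:
  assumes b: "b \<in> R" "b \<notin> M"
  shows "(\<Sum>c\<in>transversal. \<chi> c * \<chi> (c + b)) = - 1"
proof -
  have zb: "z * b \<in> R" "z * b \<notin> M"
    using mult_R[OF z_R b(1)] cancel[OF z_R b] power_notin_M[of 1] by auto
  \<comment> \<open>Inversion of \<open>c\<close> is realised by reversing the exponents
    \<open>i < n\<close>. The inverse of \<open>z ^ (n - Suc i)\<close> is \<open>z ^ Suc i\<close>,
    whose surplus factor \<open>z\<close> is absorbed into \<open>b\<close>.\<close>
  have step: "\<chi> (z ^ (n - Suc i)) * \<chi> (z ^ (n - Suc i) + b) = \<chi> (1 + z ^ i * (z * b))"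
    if "i < n" for i
  proof -
    have "z ^ (n - Suc i) * z ^ Suc i = 1"
      using that z_power_inverse[of "Suc i"] by (simp add: mult.commute)
    moreover have "z ^ (n - Suc i) * (1 + z ^ i * (z * b))
        = z ^ (n - Suc i) + (z ^ (n - Suc i) * z ^ Suc i) * b"
      by (simp add: algebra_simps)
    ultimately have "z ^ (n - Suc i) + b = z ^ (n - Suc i) * (1 + z ^ i * (z * b))"
      by simp
    then have "\<chi> (z ^ (n - Suc i) + b) = \<chi> (z ^ (n - Suc i)) * \<chi> (1 + z ^ i * (z * b))"
      using character_mult[OF power_R, of "1 + z ^ i * (z * b)"]
      by (simp add: add_R one_R mult_R power_R zb)
    then show ?thesis
      using character_square(1)[OF power_notin_M] by (simp flip: mult.assoc)
  qed
  have "(\<Sum>c\<in>transversal. \<chi> c * \<chi> (c + b)) = (\<Sum>i<n. \<chi> (z ^ i) * \<chi> (z ^ i + b))"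
    using zero_M by (simp add: sum_transversal character_zero)
  also have "\<dots> = (\<Sum>i<n. \<chi> (z ^ (n - Suc i)) * \<chi> (z ^ (n - Suc i) + b))"
    by (rule sum.nat_diff_reindex[symmetric])
  also have "\<dots> = (\<Sum>i<n. \<chi> (1 + z ^ i * (z * b)))"
    using step by simp
  also have "\<dots> = (\<Sum>c\<in>transversal. \<chi> (1 + c * (z * b))) - 1"
    by (simp add: sum_transversal character_one)
  finally show ?thesis
    using sum_character_affine[OF one_R zb] by simp
qed

text \<open>The Paley matrix; \<^term>\<open>None\<close> is the point at infinity of the projective line.\<close>

definition paley :: "'a option \<Rightarrow> 'a option \<Rightarrow> int" where
  "paley i k = (case (i, k) of
     (None, None) \<Rightarrow> 0 | (Some a, Some b) \<Rightarrow> \<chi> (a - b) | _ \<Rightarrow> 1)"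

definition paley_points :: "'a option set" where
  "paley_points = insert None (Some ` transversal)"

lemma card_paley_points: "card paley_points = n + 2"
  by (simp add: paley_points_def card_image card_transversal finite_transversal)

lemma character_diff_commute:
  assumes "a \<in> transversal" "c \<in> transversal" shows "\<chi> (a - c) = \<chi> (c - a)"
  using character_minus[OF diff_R[OF transversal_R transversal_R], OF assms] by simp

lemma paley_commute:
  "i \<in> paley_points \<Longrightarrow> k \<in> paley_points \<Longrightarrow> paley k i = paley i k"
  using character_diff_commute by (auto simp: paley_points_def paley_def)

lemma conference_matrix_paley: "conference_matrix paley_points paley"
proof -
  have sum1: "(\<Sum>c\<in>transversal. \<chi> (a - c)) = 0" if a: "a \<in> transversal" for a
  proof -
    have "- 1 \<in> R" "- 1 \<notin> M"
      using diff_R[OF zero_R one_R] minus_M[of "- 1"] one_notin_M by auto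
    then show ?thesis
      using sum_character_affine[of a "- 1"] transversal_R[OF a] by simp
  qed
  \<comment> \<open>The column \<open>None\<close> adds 1 to this sum: distinct rows become
    orthogonal, and equal rows give \<open>n + 1\<close>, one less than the order.\<close>
  have sum2: "(\<Sum>c\<in>transversal. \<chi> (a - c) * \<chi> (b - c)) = (if a = b then int n else - 1)"
    if ab: "a \<in> transversal" "b \<in> transversal" for a b
  proof -
    have "(\<Sum>c\<in>transversal. \<chi> (a - c) * \<chi> (b - c))
        = (\<Sum>c\<in>transversal. \<chi> (c - a) * \<chi> (c - a + (a - b)))"
      using ab by (intro sum.cong) (simp_all add: character_diff_commute)
    also have "\<dots> = (\<Sum>c\<in>transversal. \<chi> c * \<chi> (c + (a - b)))"
    proof (rule sum_transversal_reindex[where g = "\<lambda>x. \<chi> x * \<chi> (x + (a - b))"])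
      fix x y assume "x - y \<in> M"
      then show "\<chi> x * \<chi> (x + (a - b)) = \<chi> y * \<chi> (y + (a - b))"
        using character_cong[of x y] character_cong[of "x + (a - b)" "y + (a - b)"] by simp
    qed (use ab diff_R transversal_R in auto)
    also have "\<dots> = (if a = b then int n else - 1)"
      using sum_character_square sum_character_shift[of "a - b"]
        diff_R[OF transversal_R transversal_R, OF ab] transversal_distinct[OF ab] by auto
    finally show ?thesis .
  qed
  have sum: "sum g paley_points = g None + (\<Sum>c\<in>transversal. g (Some c))"
    for g :: "'a option \<Rightarrow> int"
    by (simp add: paley_points_def finite_transversal sum.reindex)
  have "(\<Sum>j\<in>paley_points. paley i j * paley k j)
      = (if i = k then int (card paley_points) - 1 else 0)"
    if "i \<in> paley_points" "k \<in> paley_points" for i k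
    using that unfolding sum card_paley_points
    by (auto simp: paley_points_def paley_def sum1 sum2 card_transversal split: if_splits)
  moreover have "paley i i = 0" if "i \<in> paley_points" for i
    using zero_M by (auto simp: paley_def character_zero split: option.split)
  moreover have "\<bar>paley i k\<bar> = 1" if "i \<in> paley_points" "k \<in> paley_points" "i \<noteq> k" for i k
  proof -
    have "\<bar>\<chi> (a - b)\<bar> = 1" if "a \<in> transversal" "b \<in> transversal" "a \<noteq> b" for a b
      using that character_square(2) transversal_distinct by blast
    then show ?thesis
      using that by (cases i; cases k) (auto simp: paley_points_def paley_def)
  qed
  moreover have "finite paley_points"
    by (simp add: paley_points_def finite_transversal)
  ultimately show ?thesis by (simp add: conference_matrix_def)
qed

end

section \<open>Finite fields as residue fields of cyclotomic rings\<close>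

text \<open>The subring generated by \<open>z\<close>. Multiplying only by the generator keeps
  inductions on membership short; closure under products is derived afterwards.\<close>

inductive_set adjoin :: "'a::comm_ring_1 \<Rightarrow> 'a set" for z where
  one: "1 \<in> adjoin z"
| diff: "x \<in> adjoin z \<Longrightarrow> y \<in> adjoin z \<Longrightarrow> x - y \<in> adjoin z"
| times: "x \<in> adjoin z \<Longrightarrow> x * z \<in> adjoin z"

lemma adjoin_zero: "0 \<in> adjoin z"
  using adjoin.diff[OF adjoin.one adjoin.one] by simp

lemma adjoin_add: "x \<in> adjoin z \<Longrightarrow> y \<in> adjoin z \<Longrightarrow> x + y \<in> adjoin z"
  using adjoin.diff[OF _ adjoin.diff[OF adjoin_zero], of x z y] by simp

lemma adjoin_mult:
  assumes x: "x \<in> adjoin z" and y: "y \<in> adjoin z"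
  shows "x * y \<in> adjoin z"
  using y by induction (auto simp: x right_diff_distrib intro: adjoin.diff adjoin.times simp flip: mult.assoc)

lemma adjoin_power: "x \<in> adjoin z \<Longrightarrow> x ^ k \<in> adjoin z"
  by (induction k) (auto intro: adjoin.one adjoin_mult)

lemma adjoin_self: "z \<in> adjoin z"
  using adjoin.times[OF adjoin.one] by simp

lemma adjoin_of_nat: "of_nat k \<in> adjoin z"
  by (induction k) (auto intro: adjoin_add adjoin.one adjoin_zero)

section \<open>A prime is not invertible in the cyclotomic ring\<close>

lemma finite_rat_common_denominator:
  assumes "finite A"
  shows "\<exists>d::int. 0 < d \<and> (\<forall>x\<in>A. of_int d * (x::rat) \<in> \<int>)"
  using assms
proof induction
  case empty
  then show ?case by (intro exI[of _ 1]) simp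
next
  case (insert x A)
  then obtain d :: int where d: "0 < d" "\<And>y. y \<in> A \<Longrightarrow> of_int d * y \<in> \<int>" by blast
  obtain a b where x: "x = of_int a / of_int b" "0 < b"
    by (cases x) (auto simp: Fract_of_int_quotient)
  have "of_int (b * d) * x = of_int (a * d)"
    using x by simp
  then have "of_int (b * d) * x \<in> \<int>" by (metis Ints_of_int)
  moreover have "of_int (b * d) * y \<in> \<int>" if "y \<in> A" for y
    using Ints_mult[OF Ints_of_int[of b] d(2)[OF that]] by (simp add: mult.assoc)
  ultimately show ?case
    using d(1) x(2) by (intro exI[of _ "b * d"]) auto
qed

text \<open>Extend 1 to a basis of the complex numbers over the rationals and take the coordinate of
  1.\<close>

lemma exists_additive_functional:
  "\<exists>\<phi> :: complex \<Rightarrow> rat. (\<forall>x y. \<phi> (x - y) = \<phi> x - \<phi> y) \<and> \<phi> 1 = 1"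
proof -
  interpret vector_space "\<lambda>(r::rat) (x::complex). of_rat r * x"
    by unfold_locales (simp_all add: algebra_simps of_rat_add of_rat_mult)
  have ind: "independent {1::complex}"
    by (simp add: dependent_single)
  define B where "B = extend_basis {1::complex}"
  have B: "independent B" "span B = UNIV" "1 \<in> B"
    using independent_extend_basis[OF ind] span_extend_basis[OF ind] extend_basis_superset[OF ind]
    by (auto simp: B_def)
  show ?thesis
    using representation_diff[OF B(1)] representation_basis[OF B(1,3)] B(2)
    by (intro exI[of _ "\<lambda>x. representation B x 1"]) auto
qed

text \<open>The values of a rational functional with \<open>\<phi> 1 = 1\<close> on the ring have a common
  denominator \<open>d\<close>; if \<open>p * x = 1\<close> then all \<open>p ^ k\<close> would divide \<open>d\<close>.\<close>

lemma not_unit_adjoin_root_of_unity: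
  fixes z x :: complex
  assumes z: "z ^ n = 1" "0 < n" and p: "2 \<le> p" and x: "x \<in> adjoin z"
  shows "of_nat p * x \<noteq> 1"
proof
  assume px: "of_nat p * x = 1"
  obtain \<phi> :: "complex \<Rightarrow> rat" where \<phi>: "\<And>x y. \<phi> (x - y) = \<phi> x - \<phi> y" "\<phi> 1 = 1"
    using exists_additive_functional by blast
  have \<phi>0: "\<phi> 0 = 0" using \<phi>(1)[of 0 0] by simp
  have \<phi>_add: "\<phi> (x + y) = \<phi> x + \<phi> y" for x y
    using \<phi>(1)[of x "- y"] \<phi>(1)[of 0 y] \<phi>0 by simp
  have \<phi>_nat: "\<phi> (of_nat k * y) = of_nat k * \<phi> y" for k y
    by (induction k) (simp_all add: \<phi>0 \<phi>_add distrib_right)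
  \<comment> \<open>Finitely many denominators suffice because \<open>z ^ k\<close> depends only on
    \<open>k mod n\<close>.\<close>
  obtain d :: int where d: "0 < d" "\<And>k. k < n \<Longrightarrow> of_int d * \<phi> (z ^ k) \<in> \<int>"
    using finite_rat_common_denominator[of "(\<lambda>k. \<phi> (z ^ k)) ` {..<n}"] by auto
  \<comment> \<open>The extra power \<open>z ^ k\<close> strengthens the induction: the case of a
    product with \<open>z\<close> just raises \<open>k\<close>.\<close>
  have int: "of_int d * \<phi> (y * z ^ k) \<in> \<int>" if "y \<in> adjoin z" for y k
    using that
  proof (induction arbitrary: k)
    case one
    then show ?case using d(2)[of "k mod n"] z(2) by (simp add: power_mod_order[OF z(1)])
  next
    case (diff x y)
    then show ?case by (simp add: left_diff_distrib right_diff_distrib \<phi>(1))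
  next
    case (times x)
    then show ?case using times.IH[of "Suc k"] by (simp add: mult.assoc)
  qed
  \<comment> \<open>Any exponent with \<open>d < p ^ t\<close> contradicts divisibility of
    \<open>d\<close> by \<open>p ^ t\<close>; \<open>d\<close> itself is large enough.\<close>
  define t where "t = nat d"
  have "t < 2 ^ t" by (rule less_exp)
  also have "2 ^ t \<le> p ^ t" using p by (rule power_mono) simp
  finally have "int t < int (p ^ t)" by (simp only: of_nat_less_iff)
  then have t: "d < int p ^ t" using d(1) by (simp add: t_def)
  have "of_nat (p ^ t) * x ^ t = 1"
    using px by (simp flip: power_mult_distrib)
  then have "of_nat (p ^ t) * \<phi> (x ^ t) = 1"
    using \<phi>_nat[of "p ^ t" "x ^ t"] \<phi>(2) by simp
  moreover obtain a where "of_int d * \<phi> (x ^ t) = of_int a"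
    using int[OF adjoin_power[OF x], of t 0] by (auto elim: Ints_cases)
  ultimately have "(of_int d :: rat) = of_nat (p ^ t) * of_int a"
    by (metis mult.left_commute mult.right_neutral)
  then have "(of_int d :: rat) = of_int (int p ^ t * a)" by simp
  then have "d = int p ^ t * a" by (simp only: of_int_eq_iff)
  then have "int p ^ t \<le> d" using d(1) by (auto intro: zdvd_imp_le)
  then show False using t by simp
qed

text \<open>Zorn's lemma, applied to the ideals of \<open>R\<close> that contain \<open>p\<close>
  but not 1, gives a maximal one; maximality makes it prime. The multiples of \<open>p\<close> form
  such an ideal since \<open>p\<close> is not a unit.\<close>

lemma exists_prime_ideal_containing:
  fixes R :: "'a::comm_ring_1 set"
  assumes R: "1 \<in> R" "\<And>x y. x \<in> R \<Longrightarrow> y \<in> R \<Longrightarrow> x - y \<in> R"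
      "\<And>x y. x \<in> R \<Longrightarrow> y \<in> R \<Longrightarrow> x * y \<in> R"
    and p: "p \<in> R" "\<And>x. x \<in> R \<Longrightarrow> p * x \<noteq> 1"
  obtains M where "M \<subseteq> R" "p \<in> M" "0 \<in> M" "\<And>x y. x \<in> M \<Longrightarrow> y \<in> M \<Longrightarrow> x - y \<in> M"
    "\<And>x y. x \<in> R \<Longrightarrow> y \<in> M \<Longrightarrow> x * y \<in> M" "1 \<notin> M"
    "\<And>x y. x \<in> R \<Longrightarrow> y \<in> R \<Longrightarrow> x * y \<in> M \<Longrightarrow> x \<in> M \<or> y \<in> M"
proof -
  have R0: "0 \<in> R" using R(2)[OF R(1) R(1)] by simp
  have R_add: "x + y \<in> R" if "x \<in> R" "y \<in> R" for x y
    using R(2)[OF that(1) R(2)[OF R0 that(2)]] by simp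
  define \<I> where "\<I> = {J. J \<subseteq> R \<and> p \<in> J \<and> 0 \<in> J \<and> (\<forall>x\<in>J. \<forall>y\<in>J. x - y \<in> J) \<and>
    (\<forall>x\<in>R. \<forall>y\<in>J. x * y \<in> J) \<and> 1 \<notin> J}"
  have "(\<lambda>x. p * x) ` R \<in> \<I>"
  proof -
    have "p * x - p * y \<in> (\<lambda>x. p * x) ` R" if "x \<in> R" "y \<in> R" for x y
      using R(2)[OF that] by (metis image_eqI right_diff_distrib)
    moreover have "x * (p * y) \<in> (\<lambda>x. p * x) ` R" if "x \<in> R" "y \<in> R" for x y
      using R(3)[OF that] by (metis image_eqI mult.left_commute)
    moreover have "p \<in> (\<lambda>x. p * x) ` R" "0 \<in> (\<lambda>x. p * x) ` R"
      using R(1) R0 by (metis image_eqI mult_1_right, metis image_eqI mult_zero_right)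
    ultimately show ?thesis
      unfolding \<I>_def using R(3) p by (fastforce simp: image_iff)
  qed
  then have "\<I> \<noteq> {}" by blast
  moreover have "\<Union>\<C> \<in> \<I>" if \<C>: "\<C> \<noteq> {}" "subset.chain \<I> \<C>" for \<C>
  proof -
    have sub: "\<C> \<subseteq> \<I>" and tot: "\<And>A B. A \<in> \<C> \<Longrightarrow> B \<in> \<C> \<Longrightarrow> A \<subseteq> B \<or> B \<subseteq> A"
      using \<C>(2) by (auto simp: subset_chain_def)
    have "x - y \<in> \<Union>\<C>" if "x \<in> A" "A \<in> \<C>" "y \<in> B" "B \<in> \<C>" for x y A B
    proof -
      have "\<exists>J\<in>\<C>. x \<in> J \<and> y \<in> J" using tot that by blast
      then show ?thesis using sub unfolding \<I>_def by blast
    qed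
    then have "\<forall>x\<in>\<Union>\<C>. \<forall>y\<in>\<Union>\<C>. x - y \<in> \<Union>\<C>" by blast
    moreover have "\<Union>\<C> \<subseteq> R" "1 \<notin> \<Union>\<C>" "\<forall>x\<in>R. \<forall>y\<in>\<Union>\<C>. x * y \<in> \<Union>\<C>"
      using sub unfolding \<I>_def by blast+
    moreover have "p \<in> \<Union>\<C>" "0 \<in> \<Union>\<C>"
      using \<C>(1) sub unfolding \<I>_def by blast+
    ultimately show ?thesis unfolding \<I>_def by simp
  qed
  ultimately obtain M where M: "M \<in> \<I>" and max: "\<And>X. X \<in> \<I> \<Longrightarrow> M \<subseteq> X \<Longrightarrow> X = M"
    using subset_Zorn_nonempty[of \<I>] by blast
  have M': "M \<subseteq> R" "p \<in> M" "0 \<in> M" "\<And>x y. x \<in> M \<Longrightarrow> y \<in> M \<Longrightarrow> x - y \<in> M"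
      "\<And>x y. x \<in> R \<Longrightarrow> y \<in> M \<Longrightarrow> x * y \<in> M" "1 \<notin> M"
    using M unfolding \<I>_def by blast+
  have M_add: "x + y \<in> M" if "x \<in> M" "y \<in> M" for x y
    using M'(4)[OF that(1) M'(4)[OF M'(3) that(2)]] by simp
  have "y \<in> M" if xy: "x \<in> R" "y \<in> R" "x * y \<in> M" and x: "x \<notin> M" for x y
  proof -
    \<comment> \<open>The ideal generated by \<open>M\<close> and \<open>x\<close> is strictly
      larger than \<open>M\<close>, so it contains 1; multiplying that representation of 1 by
      \<open>y\<close> puts \<open>y\<close> into \<open>M\<close>.\<close>
    define X where "X = {m + r * x | m r. m \<in> M \<and> r \<in> R}"
    have MX: "m \<in> X" if "m \<in> M" for m
      unfolding X_def using that R0 by (intro CollectI exI[of _ m] exI[of _ 0]) simp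
    have xX: "x \<in> X"
      unfolding X_def using M'(3) R(1) by (intro CollectI exI[of _ 0] exI[of _ 1]) simp
    have diff: "a - b \<in> X" if ab: "a \<in> X" "b \<in> X" for a b
    proof -
      obtain m r m' r' where eq: "a = m + r * x" "b = m' + r' * x"
        and mem: "m \<in> M" "r \<in> R" "m' \<in> M" "r' \<in> R"
        using ab unfolding X_def by blast
      have "a - b = (m - m') + (r - r') * x"
        by (simp add: eq algebra_simps)
      then show ?thesis unfolding X_def using mem M'(4) R(2) by blast
    qed
    have mult: "s * a \<in> X" if sa: "s \<in> R" "a \<in> X" for s a
    proof -
      obtain m r where eq: "a = m + r * x" and mem: "m \<in> M" "r \<in> R"
        using sa unfolding X_def by blast
      have "s * a = s * m + (s * r) * x"
        by (simp add: eq algebra_simps)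
      then show ?thesis unfolding X_def using mem M'(5) R(3) sa(1) by blast
    qed
    have "X \<subseteq> R"
      unfolding X_def using M'(1) R(3) R_add xy(1) by blast
    moreover have "X \<notin> \<I>"
      using max[of X] MX xX x by blast
    ultimately have "1 \<in> X"
      unfolding \<I>_def using MX M'(2,3) diff mult by blast
    then obtain m r where mr: "1 = m + r * x" "m \<in> M" "r \<in> R"
      unfolding X_def by blast
    have "y = y * m + r * (x * y)"
      using arg_cong[OF mr(1), of "\<lambda>u. u * y"] by (simp add: algebra_simps)
    then show "y \<in> M"
      using M_add M'(5) mr(2,3) xy by metis
  qed
  with M' that show thesis by blast
qed

section \<open>Construction of the residue field\<close>

text \<open>Two monic polynomials of degree \<open>n\<close> that agree at the \<open>n\<close>
  roots of unity are equal.\<close>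

lemma prod_minus_roots_of_unity:
  fixes x :: complex
  assumes n: "0 < n"
  shows "(\<Prod>i<n. x - cis (2 * pi / real n) ^ i) = x ^ n - 1"
proof -
  let ?U = "{w::complex. w ^ n = 1}"
  have "(\<Prod>w\<in>?U. [:- w, 1:]) = monom 1 n - 1"
  proof (rule poly_eqI_degree_lead_coeff[of _ n _ ?U])
    have fin: "finite ?U" and card: "card ?U = n"
      using n card_roots_unity_eq finite_roots_unity by auto
    have deg: "degree (\<Prod>w\<in>?U. [:- w, 1:]) = n"
      by (subst degree_prod_eq_sum_degree) (simp_all add: card)
    have "lead_coeff (\<Prod>w\<in>?U. [:- w, 1:]) = 1"
      by (simp add: lead_coeff_prod)
    then show "coeff (\<Prod>w\<in>?U. [:- w, 1:]) n = coeff (monom 1 n - 1) n"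
      using n by (simp add: deg)
    show "degree (monom 1 n - 1 :: complex poly) \<le> n"
      by (intro degree_diff_le) (simp_all add: degree_monom_eq)
    show "poly (\<Prod>w\<in>?U. [:- w, 1:]) w = poly (monom 1 n - 1) w" if "w \<in> ?U" for w
      using that fin by (auto simp: poly_prod poly_monom prod_zero_iff)
    show "n \<le> card ?U" by (simp add: card)
    show "degree (\<Prod>w\<in>?U. [:- w, 1:]) \<le> n" by (simp add: deg)
  qed
  then have "poly (\<Prod>w\<in>?U. [:- w, 1:]) x = x ^ n - 1"
    by (simp add: poly_monom)
  moreover have "(\<Prod>i<n. x - cis (2 * pi / real n) ^ i) = (\<Prod>w\<in>?U. x - w)"
    using prod.reindex_bij_betw[OF Complex.bij_betw_roots_unity[OF n], of "\<lambda>w. x - w"]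
    by (simp add: Complex.DeMoivre mult_ac)
  ultimately show ?thesis by (simp add: poly_prod)
qed

lemma exists_residue_field:
  assumes p: "prime (p::nat)" and q: "p ^ \<alpha> mod 4 = 1" "p ^ \<alpha> \<noteq> 1"
  shows "\<exists>(R :: complex set) M z. residue_field R M z (p ^ \<alpha> - 1)"
proof -
  define n where "n = p ^ \<alpha> - 1"
  define z where "z = cis (2 * pi / real n)"
  have qn: "p ^ \<alpha> = n + 1" "4 dvd n" "0 < n"
  proof -
    have "Q = Q - 1 + 1 \<and> 4 dvd Q - 1 \<and> 0 < Q - 1" if "Q mod 4 = 1" "Q \<noteq> 1" for Q :: nat
      using that by presburger
    from this[OF q] show "p ^ \<alpha> = n + 1" "4 dvd n" "0 < n" by (simp_all add: n_def)
  qed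
  have \<alpha>: "0 < \<alpha>" using q(2) by (cases \<alpha>) auto
  have z: "z ^ n = 1" using qn(3) by (simp add: z_def Complex.DeMoivre)
  let ?R = "adjoin z"
  have not_unit: "of_nat p * x \<noteq> 1" if "x \<in> ?R" for x
    using not_unit_adjoin_root_of_unity[OF z qn(3) prime_ge_2_nat[OF p] that] .
  obtain M where M: "M \<subseteq> ?R" "of_nat p \<in> M" "0 \<in> M" "\<And>x y. x \<in> M \<Longrightarrow> y \<in> M \<Longrightarrow> x - y \<in> M"
      "\<And>x y. x \<in> ?R \<Longrightarrow> y \<in> M \<Longrightarrow> x * y \<in> M" "1 \<notin> M"
      and prime_M: "\<And>x y. x \<in> ?R \<Longrightarrow> y \<in> ?R \<Longrightarrow> x * y \<in> M \<Longrightarrow> x \<in> M \<or> y \<in> M"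
    by (rule exists_prime_ideal_containing[of ?R "of_nat p"], rule adjoin.one, erule adjoin.diff,
        assumption, erule adjoin_mult, assumption, rule adjoin_of_nat, erule not_unit) blast
  have M_minus: "- x \<in> M" if "x \<in> M" for x
    using M(4)[OF M(3) that] by simp
  have M_add: "x + y \<in> M" if "x \<in> M" "y \<in> M" for x y
    using M(4)[OF that(1) M_minus[OF that(2)]] by simp
  have M_sum: "sum g A \<in> M" if "\<And>i. i \<in> A \<Longrightarrow> g i \<in> M" for g :: "nat \<Rightarrow> complex" and A
    using that by (induction A rule: infinite_finite_induct) (auto simp: M(3) M_add)
  have M_p: "of_nat k * x \<in> M" if k: "p dvd k" and x: "x \<in> ?R" for k x
  proof -
    obtain l where "k = p * l" using k by blast
    then have "of_nat k * x = (of_nat l * x) * of_nat p" by simp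
    then show ?thesis
      using M(5)[OF adjoin_mult[OF adjoin_of_nat x] M(2)] by metis
  qed
  have M_trans: "x - w \<in> M" if "x - y \<in> M" "y - w \<in> M" for x y w
    using M_add[OF that] by simp
  have power_cong: "x ^ k - y ^ k \<in> M" if "x \<in> ?R" "y \<in> ?R" "x - y \<in> M" for x y k
  proof (induction k)
    case (Suc k)
    have "x * (x ^ k - y ^ k) + y ^ k * (x - y) \<in> M"
      by (intro M_add M(5) Suc that adjoin_power)
    then show ?case by (simp add: algebra_simps)
  qed (simp add: M(3))
  \<comment> \<open>All binomial coefficients strictly between the ends are divisible by
    \<open>p\<close>, which lies in \<open>M\<close>.\<close>
  have frobenius_p: "(x + y) ^ p - (x ^ p + y ^ p) \<in> M" if xy: "x \<in> ?R" "y \<in> ?R" for x y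
  proof -
    have p0: "p > 0" using p by (simp add: prime_gt_0_nat)
    have "(x + y) ^ p = (\<Sum>k\<le>p. of_nat (p choose k) * x ^ k * y ^ (p - k))"
      by (rule binomial_ring)
    also have "{..p} = insert 0 (insert p {0<..<p})"
      by auto
    also have "(\<Sum>k\<in>\<dots>. of_nat (p choose k) * x ^ k * y ^ (p - k))
        = y ^ p + (x ^ p + (\<Sum>k\<in>{0<..<p}. of_nat (p choose k) * (x ^ k * y ^ (p - k))))"
      using p0 by (simp add: mult.assoc)
    finally have "(x + y) ^ p - (x ^ p + y ^ p)
        = (\<Sum>k\<in>{0<..<p}. of_nat (p choose k) * (x ^ k * y ^ (p - k)))"
      by simp
    moreover have "of_nat (p choose k) * (x ^ k * y ^ (p - k)) \<in> M" if "k \<in> {0<..<p}" for k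
      using that p xy by (intro M_p dvd_choose_prime adjoin_mult adjoin_power) auto
    ultimately show ?thesis by (simp only: M_sum)
  qed
  have frobenius: "(x + y) ^ (p ^ a) - (x ^ (p ^ a) + y ^ (p ^ a)) \<in> M"
    if xy: "x \<in> ?R" "y \<in> ?R" for x y a
  proof (induction a)
    case (Suc a)
    have "((x + y) ^ (p ^ a)) ^ p - (x ^ (p ^ a) + y ^ (p ^ a)) ^ p \<in> M"
      by (intro power_cong adjoin_power adjoin_add xy Suc)
    moreover have "(x ^ (p ^ a) + y ^ (p ^ a)) ^ p - ((x ^ (p ^ a)) ^ p + (y ^ (p ^ a)) ^ p) \<in> M"
      by (intro frobenius_p adjoin_power xy)
    ultimately show ?case
      using M_trans by (simp only: power_Suc2 power_mult)
  qed (simp add: M(3))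
  \<comment> \<open>The iterated Frobenius map respects the ring operations modulo \<open>M\<close>
    and fixes the generator, because \<open>z ^ (p ^ \<alpha>) = z ^ n * z = z\<close>.\<close>
  have fixed: "x ^ (p ^ \<alpha>) - x \<in> M" if "x \<in> ?R" for x
    using that
  proof induction
    case one
    then show ?case using M(3) by simp
  next
    case (diff x y)
    let ?q = "p ^ \<alpha>"
    \<comment> \<open>Additivity is applied to \<open>x - y\<close> and \<open>y\<close>, which
      gives compatibility with subtraction without tracking the sign of
      \<open>(- 1) ^ ?q\<close>.\<close>
    have "(x - y + y) ^ ?q - ((x - y) ^ ?q + y ^ ?q) \<in> M"
      by (intro frobenius adjoin.diff diff.hyps)
    then have "x ^ ?q - ((x - y) ^ ?q + y ^ ?q) \<in> M"
      by (simp only: diff_add_cancel)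
    from M(4)[OF M(4)[OF diff.IH] this]
    have "(x ^ ?q - x) - (y ^ ?q - y) - (x ^ ?q - ((x - y) ^ ?q + y ^ ?q)) \<in> M" .
    then show ?case by (simp add: algebra_simps)
  next
    case (times x)
    have "z * (x ^ (p ^ \<alpha>) - x) \<in> M"
      by (intro M(5) times.IH adjoin_self)
    moreover have "z ^ (p ^ \<alpha>) = z" by (simp add: qn(1) z)
    ultimately show ?case by (simp add: power_mult_distrib algebra_simps)
  qed
  have prod_mem: "\<exists>i<k. g i \<in> M" if "(\<Prod>i<k. g i) \<in> M" "\<And>i. g i \<in> ?R"
    for g :: "nat \<Rightarrow> complex" and k
    using that
  proof (induction k)
    case (Suc k)
    have "(\<Prod>i<k. g i) \<in> ?R"
      by (induction k) (auto intro: adjoin.one adjoin_mult Suc.prems(2))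
    then have "(\<Prod>i<k. g i) \<in> M \<or> g k \<in> M"
      using prime_M Suc.prems by simp
    then show ?case using Suc less_Suc_eq by auto
  qed (use M(6) in simp)
  \<comment> \<open>The element \<open>x ^ (p ^ \<alpha>) - x\<close> of \<open>M\<close> splits
    into \<open>x\<close> and the factors \<open>x - z ^ i\<close>; the prime ideal \<open>M\<close>
    contains one of the latter.\<close>
  have cover: "\<exists>i<n. x - z ^ i \<in> M" if x: "x \<in> ?R" "x \<notin> M" for x
  proof -
    have "x ^ (p ^ \<alpha>) - x = x * (\<Prod>i<n. x - z ^ i)"
      unfolding z_def prod_minus_roots_of_unity[OF qn(3)] by (simp add: qn(1) right_diff_distrib)
    then have "x * (\<Prod>i<n. x - z ^ i) \<in> M" using fixed[OF x(1)] by simp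
    moreover have "x - z ^ i \<in> ?R" for i
      by (intro adjoin.diff x adjoin_power adjoin_self)
    moreover from this have "(\<Prod>i<k. x - z ^ i) \<in> ?R" for k
      by (induction k) (auto intro: adjoin.one adjoin_mult)
    ultimately show ?thesis using prime_M[OF x(1)] x(2) prod_mem by blast
  qed
  \<comment> \<open>Modulo \<open>M\<close>, \<open>n = p ^ \<alpha> - 1\<close> is congruent to
    -1.\<close>
  have n_notin: "of_nat n \<notin> M"
  proof
    assume "of_nat n \<in> M"
    moreover have "of_nat (p ^ \<alpha>) * 1 \<in> M"
      using \<alpha> by (intro M_p adjoin.one) simp
    ultimately have "of_nat (p ^ \<alpha>) * 1 - of_nat n \<in> M" by (intro M(4))
    then show False using M(6) by (simp add: qn(1) del: of_nat_power)
  qed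
  have inj: "i = j" if ij: "i < n" "j < n" "z ^ i = z ^ j" for i j
  proof -
    have "z ^ i = cis (2 * pi * real i / real n)" for i
      by (simp add: z_def Complex.DeMoivre mult_ac)
    then show ?thesis
      using bij_betw_imp_inj_on[OF Complex.bij_betw_roots_unity[OF qn(3)]] ij by (simp add: inj_on_def)
  qed
  text \<open>A root of unity \<open>w \<noteq> 1\<close> of order dividing \<open>n\<close> that is congruent to 1 gives
    \<open>0 = 1 + w + \<dots> + w ^ (n - 1) \<equiv> n\<close>.\<close>
  have one_cong: "d = 0" if d: "d < n" "1 - z ^ d \<in> M" for d
  proof (rule ccontr)
    assume "d \<noteq> 0"
    then have w: "z ^ d \<noteq> 1" using inj[of d 0] d(1) by auto
    have "(z ^ d) ^ n = 1" by (metis z power_mult mult.commute power_one)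
    then have "(\<Sum>k<n. (z ^ d) ^ k) = 0" using geometric_sum[OF w] by simp
    then have "of_nat n = (\<Sum>k<n. 1 ^ k - (z ^ d) ^ k)" by (simp add: sum_subtractf)
    also have "\<dots> \<in> M"
      by (intro M_sum power_cong adjoin.one adjoin_power adjoin_self d(2))
    finally show False using n_notin by simp
  qed
  have le: "i = j" if ij: "i \<le> j" "j < n" "z ^ i - z ^ j \<in> M" for i j
  proof -
    \<comment> \<open>Multiplying by the inverse of \<open>z ^ i\<close> reduces the claim to a
      power congruent to 1.\<close>
    have "z ^ (n - i) * (z ^ i - z ^ j) \<in> M"
      by (intro M(5) ij adjoin_power adjoin_self)
    moreover have "z ^ (n - i) * z ^ i = 1"
      using ij z by (simp flip: power_add)
    moreover have "z ^ (n - i) * z ^ j = z ^ n * z ^ (j - i)"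
      using ij by (simp flip: power_add)
    ultimately have "1 - z ^ (j - i) \<in> M"
      using z by (simp add: right_diff_distrib)
    then have "j - i = 0"
      using ij by (intro one_cong) auto
    then show ?thesis using ij by simp
  qed
  have "residue_field ?R M z n"
  proof
    show "i = j" if "i < n" "j < n" "z ^ i - z ^ j \<in> M" for i j
      using le[of i j] le[of j i] M_minus[OF that(3)] that by (cases "i \<le> j") auto
  qed (use adjoin.one adjoin.diff adjoin_mult adjoin_self M(3-6) z qn cover in auto)
  then show ?thesis unfolding n_def by blast
qed

section \<open>From conference matrices to the real and complex frames\<close>

lemma exists_symmetric_conference_matrix:
  assumes "prime (p::nat)" "p ^ \<alpha> mod 4 = 1"
  shows "\<exists>(I :: complex option set) C. conference_matrix I C \<and>
    (\<forall>i\<in>I. \<forall>k\<in>I. C k i = C i k) \<and> card I = p ^ \<alpha> + 1"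
proof (cases "p ^ \<alpha> = 1")
  case True
  \<comment> \<open>The degenerate exponent \<open>\<alpha> = 0\<close> comes with no field; the
    exchange matrix of order 2 takes the place of the Paley matrix.\<close>
  have "conference_matrix {None, Some (0::complex)} (\<lambda>i k. if i = k then 0 else 1)"
    by (auto simp: conference_matrix_def)
  then show ?thesis
    using True by (intro exI[of _ "{None, Some 0}"] exI[of _ "\<lambda>i k. if i = k then 0 else 1"]) auto
next
  case False
  then obtain R M :: "complex set" and z where "residue_field R M z (p ^ \<alpha> - 1)"
    using exists_residue_field assms by blast
  then interpret residue_field R M z "p ^ \<alpha> - 1" .
  have "card paley_points = p ^ \<alpha> + 1"
    using card_paley_points n_pos by simp
  then show ?thesis
    using conference_matrix_paley paley_commute by blast
qed

theorem corollary2p6: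
  fixes N :: nat
  assumes "N = 2 * CARD('m::finite)"
  shows "(\<forall>(p::nat) (\<alpha>::nat). prime p \<and> N = p ^ \<alpha> + 1 \<and> p ^ \<alpha> mod 4 = 1 \<longrightarrow>
            (\<exists>f :: nat \<Rightarrow> real ^ 'm. optimal_grassmannian_frame inner N f)) \<and>
         (\<forall>\<alpha>::nat. CARD('m) = 2 ^ \<alpha> \<longrightarrow>
            (\<exists>f :: nat \<Rightarrow> complex ^ 'm. optimal_grassmannian_frame hermitian_inner N f))"
proof (intro conjI allI impI)
  fix p \<alpha> :: nat
  assume "prime p \<and> N = p ^ \<alpha> + 1 \<and> p ^ \<alpha> mod 4 = 1"
  moreover from this obtain I :: "complex option set" and C where
    "conference_matrix I C" "\<And>i k. i \<in> I \<Longrightarrow> k \<in> I \<Longrightarrow> C k i = C i k" "card I = p ^ \<alpha> + 1"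
    using exists_symmetric_conference_matrix by blast
  ultimately show "\<exists>f :: nat \<Rightarrow> real ^ 'm. optimal_grassmannian_frame inner N f"
    using symmetric_conference_imp_real_frame[of I C, where 'm = 'm] assms by simp
next
  fix \<alpha> :: nat
  assume "CARD('m) = 2 ^ \<alpha>"
  \<comment> \<open>The matrix must have order \<open>N\<close>, twice the dimension, hence one
    doubling more than \<open>\<alpha>\<close>.\<close>
  then have "card {x :: bool list. length x = Suc \<alpha>} = 2 * CARD('m)"
    by (simp add: card_bool_lists)
  then show "\<exists>f :: nat \<Rightarrow> complex ^ 'm. optimal_grassmannian_frame hermitian_inner N f"
    unfolding assms
    by (intro skew_conference_imp_complex_frame[OF conference_matrix_skew_conference])
       (auto intro: skew_conference_commute)
qed

end
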